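(* Let $(M,\tau)$ be a noncommutative, faithful, tracial probability space and let $(x_i)_{i\in\mathbb{N}}$ be a sequence of free, centered (i.e. $\tau(x_i)=0$), identically distributed, self-adjoint random variables in $(M,\tau)$ with unit norm (i.e. $\|x_i\|_2=1$). Let $s_k:=x_1+\cdots+x_k$ for $k\ge1$. Then for all integers $1\le m\le n$, $$\Sigma^*\left(\frac{s_n}{\sqrt n}\,\Big|\, S\right)\le\sqrt{\frac mn}\;\Sigma^*\left(\frac{s_m}{\sqrt m}\,\Big|\, S\right),$$ where $\Sigma^*(\,\cdot\mid S)$ is the free Stein discrepancy relative to a standard semicircular variable $S$.
   Context: A noncommutative, faithful, tracial probability space $(M,\tau)$ is a unital $*$-algebra $M$ over $\mathbb{C}$ with a linear form $\tau:M\to\mathbb{C}$ satisfying $\tau(x^* )=\overline{\tau(x)}$, $\tau(1)=1$, $\tau(xy)=\tau(yx)$, $\tau(x^*x)\ge 0$ for all $x,y\in M$, and $\tau(x^*x)=0$ if and only if $x=0$. Unital sub-algebras $M_1,M_2,\ldots\subseteq M$ are free if $\tau(a_1\cdots a_r)=0$ whenever $r\geq 1$, $a_j\in M_{i_j}$, $\tau(a_j)=0$ for all $j$, and $i_1\ne i_2,\ldots,i_{r-1}\ne i_r$. Random variables are free if the unital sub-$*$-algebras they generate are free. Identically distributed means $\tau(x_i^r)$ does not depend on $i$, for every $r\ge 1$. $L^2(M)$ is the Hilbert space completion of $M$ for $\langle x,y\rangle:=\tau(x^*y)$, with norm $\|x\|_2=\sqrt{\langle x,x\rangle}$, and $L^2(M)\otimes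 L^2(M)$ is the Hilbert space tensor product. The noncommutative derivative $\partial:\mathbb{C}[X]\to\mathbb{C}[X]\otimes\mathbb{C}[X]$ is the linear map with $\partial X^r=\sum_{k=0}^{r-1}X^k\otimes X^{r-1-k}$ (and $\partial 1=0$); $\partial P(x)$ denotes its evaluation at $X=x$ in both tensor factors. A free Stein kernel of a self-adjoint $x\in M$ is an element $K\in L^2(M)\otimes L^2(M)$ such that $\langle x,P(x)\rangle=\langle K,\partial P(x)\rangle$ for every polynomial $P\in\mathbb{C}[X]$. The free Stein discrepancy of $x$ relative to $S$ is $$\Sigma^*(x\mid S):=\inf_K\|K-1\otimes 1\|_{L^2(M)\otimes L^2(M)},$$ the infimum being over all free Stein kernels $K$ of $x$ (with the usual convention $\inf\emptyset=+\infty$). Here $S$ is a standard semicircular variable (distribution with density $\frac1{2\pi}\sqrt{4-t^2}\,\mathbf 1_{[-2,2]}(t)$); it enters only through this formula. *)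

theory Defs
  imports "HOL-Analysis.Analysis" "HOL-Computational_Algebra.Polynomial"
begin

section \<open>Complex vector spaces, *-algebras and Hilbert spaces\<close>

class complex_vector = ab_group_add +
  fixes scaleC :: "complex \<Rightarrow> 'a \<Rightarrow> 'a"  (infixr \<open>*\<^sub>C\<close> 75)
  assumes scaleC_add_right: "a *\<^sub>C (x + y) = a *\<^sub>C x + a *\<^sub>C y"
    and scaleC_add_left: "(a + b) *\<^sub>C x = a *\<^sub>C x + b *\<^sub>C x"
    and scaleC_scaleC: "a *\<^sub>C b *\<^sub>C x = (a * b) *\<^sub>C x"
    and scaleC_one: "1 *\<^sub>C x = x"

global_interpretation complex_vector: vector_space "scaleC :: complex \<Rightarrow> 'a \<Rightarrow> 'a :: complex_vector"
  by unfold_locales (simp_all add: scaleC_add_right scaleC_add_left scaleC_scaleC scaleC_one)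

text \<open>\<open>ring_1\<close> contains \<open>0 \<noteq> 1\<close>; this is no restriction below, where there is
  a linear form with value \<open>1\<close> at \<open>1\<close>.\<close>

class star_algebra_1 = complex_vector + ring_1 +
  fixes star :: "'a \<Rightarrow> 'a"
  assumes scaleC_mult_left: "(a *\<^sub>C x) * y = a *\<^sub>C (x * y)"
    and scaleC_mult_right: "x * (a *\<^sub>C y) = a *\<^sub>C (x * y)"
    and star_star: "star (star x) = x"
    and star_add: "star (x + y) = star x + star y"
    and star_scaleC: "star (a *\<^sub>C x) = cnj a *\<^sub>C star x"
    and star_mult: "star (x * y) = star y * star x"

text \<open>Complex Hilbert spaces, with inner product linear in the second argument. The real
  inner product, the norm and the topology of the library are those underlying \<open>cinner\<close>:
  in particular \<open>(norm x)\<^sup>2 = Re (cinner x x)\<close>.\<close>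

class complex_hilbert_space = complex_vector + real_inner + complete_space +
  fixes cinner :: "'a \<Rightarrow> 'a \<Rightarrow> complex"
  assumes scaleR_scaleC: "r *\<^sub>R x = complex_of_real r *\<^sub>C x"
    and cinner_add_right: "cinner x (y + z) = cinner x y + cinner x z"
    and cinner_scaleC_right: "cinner x (a *\<^sub>C y) = a * cinner x y"
    and cinner_commute: "cinner y x = cnj (cinner x y)"
    and Re_cinner: "Re (cinner x y) = inner x y"

lemma cinner_self: "cinner x x = complex_of_real ((norm x)\<^sup>2)"
proof (rule complex_eqI)
  show "Re (cinner x x) = Re (complex_of_real ((norm x)\<^sup>2))"
    by (simp only: Re_cinner Re_complex_of_real power2_norm_eq_inner)
  have "Im (cinner x x) = Im (cnj (cinner x x))"
    by (subst cinner_commute) simp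
  then show "Im (cinner x x) = Im (complex_of_real ((norm x)\<^sup>2))"
    by simp
qed


section \<open>Noncommutative probability spaces and freeness\<close>

locale nc_prob_space =
  fixes \<tau> :: "'a::star_algebra_1 \<Rightarrow> complex"
  assumes linear: "Vector_Spaces.linear (*\<^sub>C) (*) \<tau>"
    and trace_star: "\<tau> (star x) = cnj (\<tau> x)"
    and trace_one: "\<tau> 1 = 1"
    and tracial: "\<tau> (x * y) = \<tau> (y * x)"
    and nonneg: "\<tau> (star x * x) \<in> \<real>\<^sub>\<ge>\<^sub>0"
    and faithful: "\<tau> (star x * x) = 0 \<longleftrightarrow> x = 0"

definition unital_star_subalgebra :: "'a::star_algebra_1 set \<Rightarrow> bool" where
  "unital_star_subalgebra A \<longleftrightarrow> 1 \<in> A \<and> (\<forall>x\<in>A. \<forall>y\<in>A. x + y \<in> A) \<and> (\<forall>x\<in>A. \<forall>y\<in>A. x * y \<in> A)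
     \<and> (\<forall>c. \<forall>x\<in>A. c *\<^sub>C x \<in> A) \<and> (\<forall>x\<in>A. star x \<in> A)"

definition generated_star_subalgebra :: "'a::star_algebra_1 set \<Rightarrow> 'a set" where
  "generated_star_subalgebra S = \<Inter>{A. unital_star_subalgebra A \<and> S \<subseteq> A}"

definition free_subalgebras :: "('a::star_algebra_1 \<Rightarrow> complex) \<Rightarrow> ('i \<Rightarrow> 'a set) \<Rightarrow> bool" where
  "free_subalgebras \<tau> M \<longleftrightarrow>
     (\<forall>r\<ge>1. \<forall>(i :: nat \<Rightarrow> 'i) (a :: nat \<Rightarrow> 'a).
        (\<forall>j<r. a j \<in> M (i j) \<and> \<tau> (a j) = 0) \<longrightarrow>
        (\<forall>j. Suc j < r \<longrightarrow> i j \<noteq> i (Suc j)) \<longrightarrow>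
        \<tau> (prod_list (map a [0..<r])) = 0)"

definition free_variables :: "('a::star_algebra_1 \<Rightarrow> complex) \<Rightarrow> ('i \<Rightarrow> 'a) \<Rightarrow> bool" where
  "free_variables \<tau> x \<longleftrightarrow> free_subalgebras \<tau> (\<lambda>i. generated_star_subalgebra {x i})"

definition identically_distributed :: "('a::star_algebra_1 \<Rightarrow> complex) \<Rightarrow> ('i \<Rightarrow> 'a) \<Rightarrow> bool" where
  "identically_distributed \<tau> x \<longleftrightarrow> (\<forall>r\<ge>1. \<forall>i j. \<tau> (x i ^ r) = \<tau> (x j ^ r))"


section \<open>The Hilbert spaces \<open>L\<^sup>2(M)\<close> and \<open>L\<^sup>2(M) \<otimes> L\<^sup>2(M)\<close>\<close>

text \<open>A Hilbert space completion and a Hilbert space tensor product are determined only up to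
  unitary isomorphism. The following predicates say that given Hilbert spaces, together with
  the canonical map \<open>\<iota>\<close> from \<open>M\<close> and the canonical bilinear map \<open>tens\<close> (the elementary
  tensors), are such a completion and such a tensor product.\<close>

locale L2_completion = nc_prob_space \<tau>
  for \<tau> :: "'a::star_algebra_1 \<Rightarrow> complex" +
  fixes \<iota> :: "'a \<Rightarrow> 'h::complex_hilbert_space"
  assumes linear_embedding: "Vector_Spaces.linear (*\<^sub>C) (*\<^sub>C) \<iota>"
    and cinner_embedding: "cinner (\<iota> x) (\<iota> y) = \<tau> (star x * y)"
    and dense_embedding: "closure (range \<iota>) = UNIV"

locale hilbert_tensor_product =
  fixes tens :: "'h::complex_hilbert_space \<Rightarrow> 'k::complex_hilbert_space \<Rightarrow> 't::complex_hilbert_space"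
  assumes linear_tens_left: "Vector_Spaces.linear (*\<^sub>C) (*\<^sub>C) (\<lambda>u. tens u v)"
    and linear_tens_right: "Vector_Spaces.linear (*\<^sub>C) (*\<^sub>C) (\<lambda>v. tens u v)"
    and cinner_tens: "cinner (tens u v) (tens u' v') = cinner u u' * cinner v v'"
    and dense_tens: "closure (complex_vector.span {tens u v | u v. True}) = UNIV"


section \<open>Free Stein kernels and the free Stein discrepancy\<close>

definition poly_eval :: "complex poly \<Rightarrow> 'a::star_algebra_1 \<Rightarrow> 'a" where
  "poly_eval P x = (\<Sum>r\<le>degree P. coeff P r *\<^sub>C x ^ r)"

text \<open>The algebraic tensor product of \<open>\<complex>[X]\<close> with itself is represented by
  \<open>complex poly poly\<close>, where \<open>X\<^sup>k \<otimes> X\<^sup>l\<close> is the monomial \<open>pure_tensor k l\<close>.\<close>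

definition pure_tensor :: "nat \<Rightarrow> nat \<Rightarrow> complex poly poly" where
  "pure_tensor k l = monom (monom 1 l) k"

definition nc_deriv :: "complex poly \<Rightarrow> complex poly poly" where
  "nc_deriv P = (\<Sum>r\<le>degree P. smult [:coeff P r:] (\<Sum>k<r. pure_tensor k (r - 1 - k)))"

lemma nc_deriv_altdef:
  assumes "degree P \<le> n"
  shows "nc_deriv P = (\<Sum>r\<le>n. smult [:coeff P r:] (\<Sum>k<r. pure_tensor k (r - 1 - k)))"
  unfolding nc_deriv_def
  by (rule sum.mono_neutral_left) (use assms in \<open>auto simp: coeff_eq_0\<close>)

lemma nc_deriv_monom: "nc_deriv (monom 1 r) = (\<Sum>k<r. pure_tensor k (r - 1 - k))"
proof -
  have "nc_deriv (monom 1 r)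
      = (\<Sum>s\<le>r. if s = r then \<Sum>k<r. pure_tensor k (r - 1 - k) else 0)"
    unfolding nc_deriv_altdef[OF degree_monom_le]
    by (rule sum.cong) (auto simp: pCons_one)
  then show ?thesis by simp
qed

lemma nc_deriv_add: "nc_deriv (P + Q) = nc_deriv P + nc_deriv Q"
proof -
  let ?n = "max (degree P) (degree Q)"
  have "nc_deriv (P + Q) = (\<Sum>r\<le>?n. smult [:coeff (P + Q) r:] (\<Sum>k<r. pure_tensor k (r - 1 - k)))"
    by (rule nc_deriv_altdef) (rule degree_add_le_max)
  also have "\<dots> = nc_deriv P + nc_deriv Q"
    unfolding nc_deriv_altdef[of P ?n, simplified] nc_deriv_altdef[of Q ?n, simplified]
    by (simp add: sum.distrib[symmetric] smult_add_left[symmetric])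
  finally show ?thesis .
qed

lemma nc_deriv_smult: "nc_deriv (smult c P) = smult [:c:] (nc_deriv P)"
proof -
  have "nc_deriv (smult c P)
      = (\<Sum>r\<le>degree P. smult [:coeff (smult c P) r:] (\<Sum>k<r. pure_tensor k (r - 1 - k)))"
    by (rule nc_deriv_altdef) (rule degree_smult_le)
  also have "\<dots> = (\<Sum>r\<le>degree P. [:[:c:]:] * smult [:coeff P r:] (\<Sum>k<r. pure_tensor k (r - 1 - k)))"
    by simp
  also have "\<dots> = [:[:c:]:] * nc_deriv P"
    by (simp only: nc_deriv_def sum_distrib_left)
  finally show ?thesis by simp
qed

text \<open>Evaluation at \<open>X = x\<close> in both tensor factors, as an element of
  \<open>L\<^sup>2(M) \<otimes> L\<^sup>2(M)\<close>.\<close>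

definition tensor_eval ::
  "('a::star_algebra_1 \<Rightarrow> 'h) \<Rightarrow> ('h \<Rightarrow> 'h \<Rightarrow> 't::complex_hilbert_space) \<Rightarrow> complex poly poly \<Rightarrow> 'a \<Rightarrow> 't" where
  "tensor_eval \<iota> tens Q x =
     (\<Sum>k\<le>degree Q. \<Sum>l\<le>degree (coeff Q k). coeff (coeff Q k) l *\<^sub>C tens (\<iota> (x ^ k)) (\<iota> (x ^ l)))"

definition free_stein_kernel ::
  "('a::star_algebra_1 \<Rightarrow> 'h::complex_hilbert_space) \<Rightarrow> ('h \<Rightarrow> 'h \<Rightarrow> 't::complex_hilbert_space) \<Rightarrow> 'a \<Rightarrow> 't \<Rightarrow> bool" where
  "free_stein_kernel \<iota> tens x K \<longleftrightarrow>
     (\<forall>P. cinner (\<iota> x) (\<iota> (poly_eval P x)) = cinner K (tensor_eval \<iota> tens (nc_deriv P) x))"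

text \<open>The discrepancy relative to a standard semicircular variable. That variable enters only
  through the element \<open>1 \<otimes> 1\<close>, hence is not an argument. The infimum of the empty set is
  \<open>\<infinity>\<close>.\<close>

definition free_stein_discrepancy ::
  "('a::star_algebra_1 \<Rightarrow> 'h::complex_hilbert_space) \<Rightarrow> ('h \<Rightarrow> 'h \<Rightarrow> 't::complex_hilbert_space) \<Rightarrow> 'a \<Rightarrow> ereal" where
  "free_stein_discrepancy \<iota> tens x =
     (INF K\<in>{K. free_stein_kernel \<iota> tens x K}. ereal (norm (K - tens (\<iota> 1) (\<iota> 1))))"

end

theory Submission
  imports Defs "HOL-Computational_Algebra.Formal_Power_Series"
begin

unbundle no vec_syntax
unbundle fps_syntax

text \<open>By duality, a free Stein kernel \<open>K\<close> of \<open>y\<close> with \<open>\<parallel>K - 1 \<otimes> 1\<parallel> \<le> C\<close> exists as soon as the functional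
  \<open>P \<mapsto> \<langle>y, P(y)\<rangle> - \<langle>1 \<otimes> 1, \<partial>P(y)\<rangle>\<close> is bounded by \<open>C \<parallel>\<partial>P(y)\<parallel>\<close>, so that only algebra is needed.
  Let \<open>s\<^sub>S\<close> be the sum of the variables in an \<open>m\<close>-element set \<open>S \<subseteq> {1..n}\<close>, and \<open>E\<^sub>S\<close> the conditional
  expectation onto the algebra generated by them. Subordination for formal resolvents,
  \<open>E\<^sub>S (1 - t s\<^sub>n)\<^sup>-\<^sup>1 = (1 - t (s\<^sub>S + c(t)))\<^sup>-\<^sup>1\<close> with a scalar series \<open>c\<close>, shows that \<open>E\<^sub>S P(s\<^sub>n) = Q(s\<^sub>S)\<close> for a
  polynomial \<open>Q\<close> that depends only on \<open>m\<close>, and that \<open>(E\<^sub>S \<otimes> E\<^sub>S) \<partial>P(s\<^sub>n) = \<partial>Q(s\<^sub>S)\<close>.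
  Expanding \<open>\<partial>P(s\<^sub>n)\<close> into orthogonal pairs of reduced words, the projections \<open>E\<^sub>S \<otimes> E\<^sub>S\<close> become
  restrictions to words over \<open>S\<close>, and averaging over all \<open>S\<close> gains the factor \<open>m / n\<close> on the orthogonal
  complement of \<open>1 \<otimes> 1\<close>, as in the Efron-Stein inequality.\<close>

section \<open>Complex Hilbert spaces\<close>

lemma cinner_add_left: "cinner (x + y) z = cinner x z + cinner y z"
  by (metis cinner_add_right cinner_commute complex_cnj_add)

lemma cinner_scaleC_left: "cinner (a *\<^sub>C x) y = cnj a * cinner x y"
  by (metis cinner_commute cinner_scaleC_right complex_cnj_mult)

lemma cinner_zero_right [simp]: "cinner x 0 = 0"
  using cinner_add_right[of x 0 0] by simp

lemma cinner_zero_left [simp]: "cinner 0 x = 0"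
  using cinner_add_left[of 0 0 x] by simp

lemma cinner_diff_left: "cinner (x - y) z = cinner x z - cinner y z"
  using cinner_add_left[of "x - y" y z] by simp

lemma cinner_sum_right: "cinner x (sum f A) = (\<Sum>a\<in>A. cinner x (f a))"
  by (induction A rule: infinite_finite_induct) (simp_all add: cinner_add_right)

lemma cinner_sum_left: "cinner (sum f A) x = (\<Sum>a\<in>A. cinner (f a) x)"
  by (induction A rule: infinite_finite_induct) (simp_all add: cinner_add_left)

lemma norm_scaleC: "norm (a *\<^sub>C (x :: 'a::complex_hilbert_space)) = cmod a * norm x"
proof -
  have "complex_of_real ((norm (a *\<^sub>C x))\<^sup>2) = cnj a * (a * cinner x x)"
    by (simp only: cinner_self[symmetric] cinner_scaleC_left cinner_scaleC_right mult.left_commute)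
  also have "\<dots> = (a * cnj a) * cinner x x"
    by (simp only: mult.assoc mult.left_commute)
  also have "\<dots> = complex_of_real ((cmod a * norm x)\<^sup>2)"
    by (simp only: cinner_self complex_norm_square[symmetric] power_mult_distrib of_real_mult of_real_power)
  finally show ?thesis
    by (simp only: of_real_eq_iff) (simp add: power2_eq_iff_nonneg)
qed

text \<open>Multiplying \<open>y\<close> by a unimodular \<open>a\<close> makes a nonzero pairing
  real and positive, which reduces the claim to the real inequality.\<close>

lemma cinner_Cauchy_Schwarz: "cmod (cinner x y) \<le> norm x * norm y"
proof (cases "cinner x y = 0")
  case False
  define a where "a = cnj (cinner x y) / cmod (cinner x y)"
  have "cmod a = 1" using False by (simp add: a_def norm_divide)
  have "complex_of_real (cmod (cinner x y)) = a * cinner x y"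
    using False by (simp add: a_def complex_norm_square[symmetric] power2_eq_square
        mult.commute[of "cnj _"] divide_simps flip: of_real_mult)
  also have "\<dots> = cinner x (a *\<^sub>C y)" by (simp add: cinner_scaleC_right)
  finally have "cmod (cinner x y) = inner x (a *\<^sub>C y)"
    by (metis Re_cinner Re_complex_of_real)
  also have "\<dots> \<le> norm x * norm (a *\<^sub>C y)"
    by (rule norm_cauchy_schwarz)
  finally show ?thesis by (simp add: norm_scaleC \<open>cmod a = 1\<close>)
qed simp

text \<open>A Riesz representation theorem: the bound makes \<open>\<phi>\<close> factor through
  \<open>T\<close>, and \<open>D\<close> is found in the closure of the range of \<open>T\<close> by
  minimising a quadratic functional.\<close>

lemma bounded_linear_functional_representation:
  fixes scale :: "complex \<Rightarrow> 'v::ab_group_add \<Rightarrow> 'v"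
    and T :: "'v \<Rightarrow> 'h::complex_hilbert_space" and \<phi> :: "'v \<Rightarrow> complex"
  assumes T: "Vector_Spaces.linear scale (*\<^sub>C) T"
    and \<phi>: "Vector_Spaces.linear scale (*) \<phi>"
    and bound: "\<And>v. cmod (\<phi> v) \<le> C * norm (T v)"
    and "0 \<le> C"
  obtains D where "\<And>v. cinner D (T v) = \<phi> v" "norm D \<le> C"
proof -
  interpret T: Vector_Spaces.linear scale "(*\<^sub>C)" T by (rule T)
  interpret \<phi>: Vector_Spaces.linear scale "(*)" \<phi> by (rule \<phi>)
  \<comment> \<open>For a representing vector \<open>D\<close>, \<open>J v\<close> is the squared
    distance of \<open>T v\<close> and \<open>D\<close> minus the squared norm of
    \<open>D\<close>.\<close>
  define J where "J v = (norm (T v))\<^sup>2 - 2 * Re (\<phi> v)" for v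
  define \<delta> where "\<delta> = Inf (range J)"
  have J_lower: "- C\<^sup>2 \<le> J v" for v
  proof -
    have "Re (\<phi> v) \<le> C * norm (T v)"
      using complex_Re_le_cmod bound order_trans by blast
    moreover have "0 \<le> (norm (T v) - C)\<^sup>2" by simp
    ultimately show ?thesis by (simp add: J_def power2_eq_square algebra_simps)
  qed
  then have bdd: "bdd_below (range J)" by (auto intro: bdd_belowI[of _ "- C\<^sup>2"])
  then have \<delta>_le: "\<delta> \<le> J v" for v by (auto simp: \<delta>_def intro: cInf_lower)
  have "\<exists>v. J v < \<delta> + 1 / Suc k" for k :: nat
    using cInf_lessD[of "range J" "\<delta> + 1 / Suc k"] by (auto simp: \<delta>_def)
  then obtain v where v: "\<And>k :: nat. J (v k) < \<delta> + 1 / Suc k" by metis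
  \<comment> \<open>Since \<open>J\<close> is at least \<open>\<delta>\<close> at the midpoint of
    \<open>u\<close> and \<open>w\<close>, near-minimisers have nearby images; minimising sequences
    are therefore Cauchy under \<open>T\<close>.\<close>
  have parallelogram: "(norm (T u - T w))\<^sup>2 \<le> 2 * J u + 2 * J w - 4 * \<delta>" for u w
  proof -
    have "scale (1/2) (u + w) = scale (of_real (1/2)) (u + w)" by simp
    then have half: "T (scale (1/2) (u + w)) = (1/2) *\<^sub>R (T u + T w)"
      by (simp only: T.scale T.add scaleR_scaleC)
    have "2 * J u + 2 * J w - 4 * J (scale (1/2) (u + w)) = (norm (T u - T w))\<^sup>2"
      unfolding J_def half
      by (simp add: \<phi>.scale \<phi>.add power2_norm_eq_inner inner_add_left inner_add_right
          inner_diff_left inner_diff_right inner_commute algebra_simps)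
    with \<delta>_le[of "scale (1/2) (u + w)"] show ?thesis by linarith
  qed
  have "Cauchy (\<lambda>k. T (v k))"
  proof (rule metric_CauchyI)
    fix e :: real assume "e > 0"
    then obtain N :: nat where N: "4 / e\<^sup>2 < N" using reals_Archimedean2 by blast
    have "dist (T (v i)) (T (v j)) < e" if "i \<ge> N" "j \<ge> N" for i j
    proof -
      have "1 / real (Suc i) \<le> 1 / real (Suc N)" "1 / real (Suc j) \<le> 1 / real (Suc N)"
        using that by (auto simp: divide_simps)
      with parallelogram[of "v i" "v j"] v[of i] v[of j]
      have "(norm (T (v i) - T (v j)))\<^sup>2 < 4 / real (Suc N)" by simp
      also have "\<dots> < e\<^sup>2"
      proof -
        have "4 < e\<^sup>2 * real N" using N \<open>e > 0\<close> by (simp add: field_simps)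
        also have "\<dots> \<le> e\<^sup>2 * real (Suc N)" by (intro mult_left_mono) auto
        finally show ?thesis by (simp add: field_simps)
      qed
      finally show ?thesis
        using \<open>e > 0\<close> by (simp add: dist_norm power2_less_imp_less)
    qed
    then show "\<exists>N. \<forall>i\<ge>N. \<forall>j\<ge>N. dist (T (v i)) (T (v j)) < e" by blast
  qed
  then obtain D where D: "(\<lambda>k. T (v k)) \<longlonglongrightarrow> D"
    using Cauchy_convergent_iff convergent_def by blast
  have Re_eq: "inner D (T w) = Re (\<phi> w)" for w
  proof -
    define b where "b = inner D (T w) - Re (\<phi> w)"
    \<comment> \<open>First variation: the minimising sequence is perturbed by \<open>r\<close>
      times \<open>w\<close>, and the inequality survives in the limit.\<close>
    have variation: "0 \<le> r\<^sup>2 * (norm (T w))\<^sup>2 + 2 * r * b" for r :: real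
    proof -
      have "\<delta> \<le> (\<delta> + 1 / Suc k) + r\<^sup>2 * (norm (T w))\<^sup>2 + 2 * r * (inner (T (v k)) (T w) - Re (\<phi> w))" for k :: nat
      proof -
        have "J (v k + scale (of_real r) w)
            = J (v k) + r\<^sup>2 * (norm (T w))\<^sup>2 + 2 * r * (inner (T (v k)) (T w) - Re (\<phi> w))"
          unfolding J_def power2_norm_eq_inner
          by (simp add: T.scale T.add \<phi>.scale \<phi>.add scaleR_scaleC[symmetric]
              inner_add_left inner_add_right inner_commute algebra_simps power2_eq_square)
        with \<delta>_le[of "v k + scale (of_real r) w"] v[of k] show ?thesis by linarith
      qed
      moreover have "(\<lambda>k. (\<delta> + 1 / Suc k) + r\<^sup>2 * (norm (T w))\<^sup>2 + 2 * r * (inner (T (v k)) (T w) - Re (\<phi> w)))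
          \<longlonglongrightarrow> (\<delta> + 0) + r\<^sup>2 * (norm (T w))\<^sup>2 + 2 * r * b"
        unfolding b_def by (intro tendsto_intros D LIMSEQ_Suc[OF lim_1_over_n])
      ultimately have "\<delta> \<le> (\<delta> + 0) + r\<^sup>2 * (norm (T w))\<^sup>2 + 2 * r * b"
        by (intro LIMSEQ_le_const[of _ _ \<delta>]) auto
      then show ?thesis by simp
    qed
    \<comment> \<open>The added 1 keeps \<open>A\<close> positive even when \<open>T w = 0\<close>;
      at \<open>r = - b / A\<close> the quadratic is negative unless \<open>b = 0\<close>.\<close>
    define A where "A = (norm (T w))\<^sup>2 + 1"
    have "A > 0" by (simp add: A_def add_nonneg_pos)
    have "0 \<le> (- b / A)\<^sup>2 * (A - 1) + 2 * (- b / A) * b"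
      using variation[of "- b / A"] by (simp add: A_def)
    also have "\<dots> = - (b\<^sup>2 * (A + 1)) / A\<^sup>2"
      using \<open>A > 0\<close> by (simp add: divide_simps) (simp add: algebra_simps power2_eq_square)
    finally have "b\<^sup>2 * (A + 1) \<le> 0" using \<open>A > 0\<close> by (simp add: field_simps)
    then have "b = 0" using \<open>A > 0\<close> by (simp add: mult_le_0_iff)
    then show ?thesis by (simp add: b_def)
  qed
  have repr: "cinner D (T w) = \<phi> w" for w
  proof (rule complex_eqI)
    show "Re (cinner D (T w)) = Re (\<phi> w)" by (simp add: Re_cinner Re_eq)
    have "Re (cinner D (T (scale \<i> w))) = Re (\<phi> (scale \<i> w))" by (simp add: Re_cinner Re_eq)
    then show "Im (cinner D (T w)) = Im (\<phi> w)"
      by (simp add: T.scale \<phi>.scale cinner_scaleC_right)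
  qed
  \<comment> \<open>The bound is applied along the minimising sequence; its limit compares the
    square of \<open>norm D\<close> with \<open>C * norm D\<close>.\<close>
  have "(\<lambda>k. inner D (T (v k))) \<longlonglongrightarrow> inner D D" by (intro tendsto_intros D)
  moreover have "(\<lambda>k. C * norm (T (v k))) \<longlonglongrightarrow> C * norm D" by (intro tendsto_intros D)
  moreover have "inner D (T w) \<le> C * norm (T w)" for w
    by (metis Re_eq bound complex_Re_le_cmod order_trans)
  ultimately have "inner D D \<le> C * norm D"
    by (meson LIMSEQ_le)
  then have "norm D * norm D \<le> C * norm D"
    by (simp add: power2_norm_eq_inner[symmetric] power2_eq_square)
  then have "norm D \<le> C"
    using \<open>0 \<le> C\<close> by (cases "norm D = 0") auto
  with repr that show thesis by blast
qed

section \<open>The noncommutative derivative and its evaluation\<close>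

lemma poly_eval_altdef: "degree P \<le> n \<Longrightarrow> poly_eval P x = (\<Sum>r\<le>n. coeff P r *\<^sub>C x ^ r)"
  unfolding poly_eval_def by (rule sum.mono_neutral_left) (auto simp: coeff_eq_0)

lemma vector_space_poly: "vector_space (smult :: complex \<Rightarrow> complex poly \<Rightarrow> complex poly)"
  by unfold_locales (simp_all add: smult_add_left smult_add_right)

lemma linear_poly_eval: "Vector_Spaces.linear smult (*\<^sub>C) (\<lambda>P. poly_eval P (x :: 'a::star_algebra_1))"
  unfolding Vector_Spaces.linear_iff
proof (intro conjI allI)
  fix P Q :: "complex poly"
  let ?n = "max (degree P) (degree Q)"
  show "poly_eval (P + Q) x = poly_eval P x + poly_eval Q x"
    by (simp add: poly_eval_altdef[of _ ?n] degree_add_le_max scaleC_add_left sum.distrib)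
next
  fix c :: complex and P :: "complex poly"
  show "poly_eval (smult c P) x = c *\<^sub>C poly_eval P x"
    by (simp add: poly_eval_altdef[of _ "degree P"] scaleC_scaleC complex_vector.scale_sum_right)
qed (auto simp: vector_space_poly complex_vector.vector_space_axioms)

global_interpretation poly_eval: Vector_Spaces.linear smult "(*\<^sub>C)" "\<lambda>P. poly_eval P (x :: 'a::star_algebra_1)"
  for x by (rule linear_poly_eval)

lemma poly_eval_monom [simp]: "poly_eval (monom c r) x = c *\<^sub>C x ^ r"
proof -
  have "poly_eval (monom c r) x = (\<Sum>k\<le>r. if k = r then c *\<^sub>C x ^ k else 0)"
    unfolding poly_eval_altdef[OF degree_monom_le] by (rule sum.cong) auto
  then show ?thesis by simp
qed

lemma poly_eval_1 [simp]: "poly_eval 1 x = 1"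
  using poly_eval_monom[of 1 0 x] by (simp add: scaleC_one monom_0 pCons_one del: poly_eval_monom)

text \<open>Monomials span the polynomials, so identities linear in \<open>P\<close> need checking
  on powers only.\<close>

lemma poly_linear_induct [case_names monom add smult]:
  assumes "\<And>r. R (monom 1 r)" "\<And>P Q. R P \<Longrightarrow> R Q \<Longrightarrow> R (P + Q)" "\<And>c P. R P \<Longrightarrow> R (smult c P)"
  shows "R (P :: 'c::comm_semiring_1 poly)"
proof -
  have "R 0" using assms(3)[OF assms(1), of 0 0] by simp
  then have "R (\<Sum>r\<in>A. smult (c r) (monom 1 r))" for A and c :: "nat \<Rightarrow> 'c"
    by (induction A rule: infinite_finite_induct) (simp_all add: assms)
  then have "R (\<Sum>r\<le>degree P. smult (coeff P r) (monom 1 r))" .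
  then show ?thesis by (simp add: smult_monom poly_as_sum_of_monoms)
qed

lemma poly_eval_pCons_0 [simp]: "poly_eval (pCons 0 P) x = x * poly_eval P x"
proof (induction P rule: poly_linear_induct)
  case (monom r)
  have "pCons 0 (monom 1 r) = (monom 1 (Suc r) :: complex poly)" by (simp only: monom_Suc)
  then show ?case by (simp only: poly_eval_monom scaleC_one power_Suc)
next
  case (add P Q)
  have "pCons 0 (P + Q) = pCons 0 P + pCons 0 Q" by simp
  then show ?case by (simp only: poly_eval.add add distrib_left)
next
  case (smult c P)
  have "pCons 0 (smult c P) = smult c (pCons 0 P)" by simp
  then show ?case by (simp only: poly_eval.scale smult scaleC_mult_right)
qed

text \<open>As in \<open>pure_tensor\<close>, the left factor sits in the outer variable and the
  right factor in the coefficients.\<close>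

definition poly_tensor :: "complex poly \<Rightarrow> complex poly \<Rightarrow> complex poly poly" where
  "poly_tensor P Q = map_poly (\<lambda>c. [:c:]) P * [:Q:]"

lemma map_poly_const_add:
  "map_poly (\<lambda>c. [:c:]) (P + Q) = map_poly (\<lambda>c. [:c :: complex:]) P + map_poly (\<lambda>c. [:c:]) Q"
  by (rule poly_eqI) (simp add: coeff_map_poly)

lemma map_poly_const_smult:
  "map_poly (\<lambda>c. [:c:]) (smult a P) = smult [:a :: complex:] (map_poly (\<lambda>c. [:c:]) P)"
  by (rule poly_eqI) (simp add: coeff_map_poly)

lemma map_poly_const_pCons_0:
  "map_poly (\<lambda>c. [:c:]) (pCons 0 P) = pCons 0 (map_poly (\<lambda>c. [:c::complex:]) P)"
  by (rule poly_eqI) (simp add: coeff_map_poly coeff_pCons split: nat.split)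

lemma pure_tensor_eq: "pure_tensor k l = poly_tensor (monom 1 k) (monom 1 l)"
  unfolding pure_tensor_def poly_tensor_def
  by (rule poly_eqI) (simp add: coeff_map_poly pCons_one)

lemma pure_tensor_Suc: "pure_tensor (Suc k) l = pCons 0 (pure_tensor k l)"
  by (simp add: pure_tensor_def monom_Suc)

lemma nc_deriv_0 [simp]: "nc_deriv 0 = 0"
  by (simp add: nc_deriv_def)

lemma nc_deriv_1 [simp]: "nc_deriv 1 = 0"
  by (simp add: nc_deriv_def)

lemma nc_deriv_sum: "nc_deriv (sum f A) = (\<Sum>a\<in>A. nc_deriv (f a))"
  by (induction A rule: infinite_finite_induct) (simp_all add: nc_deriv_add)

lemma nc_deriv_monom_Suc: "nc_deriv (monom 1 (Suc r)) = [:monom 1 r:] + pCons 0 (nc_deriv (monom 1 r))"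
proof -
  have "pCons 0 (sum f A) = (\<Sum>a\<in>A. pCons 0 (f a))" for f :: "nat \<Rightarrow> complex poly poly" and A
    using sum_distrib_left[of "[:0, 1:]" f A] by simp
  then show ?thesis
    unfolding nc_deriv_monom sum.lessThan_Suc_shift pure_tensor_Suc
    by (simp add: pure_tensor_def monom_0)
qed

text \<open>The Leibniz rule for \<open>X P\<close>: \<open>[:P:]\<close> is
  \<open>1 \<otimes> P\<close>, and the outer \<open>pCons 0\<close> multiplies by
  \<open>X \<otimes> 1\<close>.\<close>

lemma nc_deriv_pCons_0: "nc_deriv (pCons 0 P) = [:P:] + pCons 0 (nc_deriv P)"
proof (induction P rule: poly_linear_induct)
  case (monom r)
  have "pCons 0 (monom 1 r) = (monom 1 (Suc r) :: complex poly)" by (simp only: monom_Suc)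
  then show ?case by (simp only: nc_deriv_monom_Suc)
next
  case (add P Q)
  have "pCons 0 (P + Q) = pCons 0 P + pCons 0 Q" by simp
  then show ?case by (simp only: nc_deriv_add add) simp
next
  case (smult c P)
  have "pCons 0 (smult c P) = smult c (pCons 0 P)" by simp
  then show ?case by (simp only: nc_deriv_smult smult) simp
qed

text \<open>These are the coefficients of the formal resolvent \<open>1 / (1 - t (X + c(t)))\<close>.\<close>

fun resolvent_poly :: "complex fps \<Rightarrow> nat \<Rightarrow> complex poly" where
  "resolvent_poly c 0 = 1"
| "resolvent_poly c (Suc r)
     = pCons 0 (resolvent_poly c r) + (\<Sum>a\<le>r. smult (c $ (r - a)) (resolvent_poly c a))"

lemma resolvent_poly_0: "resolvent_poly 0 r = monom 1 r"
  by (induction r) (simp_all add: monom_Suc monom_0 pCons_one)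

text \<open>The derivative of a formal resolvent is \<open>t\<close> times its tensor square; the
  scalar shift by \<open>c\<close> does not change this, because derivatives of scalars
  vanish.\<close>

lemma nc_deriv_resolvent_poly:
  "nc_deriv (resolvent_poly c r)
     = (\<Sum>k<r. poly_tensor (resolvent_poly c k) (resolvent_poly c (r - 1 - k)))"
proof -
  let ?h = "\<lambda>P. map_poly (\<lambda>c. [:c:]) P :: complex poly poly"
  let ?X = "[:0, 1:] :: complex poly poly"
  define C where "C = Abs_fps (\<lambda>r. [:[:c $ r:]:])"
  define D where "D = Abs_fps (\<lambda>r. nc_deriv (resolvent_poly c r))"
  define G where "G = Abs_fps (\<lambda>r. ?h (resolvent_poly c r))"
  define H where "H = Abs_fps (\<lambda>r. [:resolvent_poly c r:])"
  have h_sum: "?h (sum f A) = (\<Sum>a\<in>A. ?h (f a))" for f :: "nat \<Rightarrow> complex poly" and A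
    by (induction A rule: infinite_finite_induct) (simp_all add: map_poly_const_add)
  have GC: "(G * C) $ q = (\<Sum>a\<le>q. smult [:c $ (q - a):] (?h (resolvent_poly c a)))" for q
    unfolding fps_mult_nth atLeast0AtMost by (rule sum.cong) (simp_all add: G_def C_def)
  have DC: "(D * C) $ q = (\<Sum>a\<le>q. smult [:c $ (q - a):] (nc_deriv (resolvent_poly c a)))" for q
    unfolding fps_mult_nth atLeast0AtMost by (rule sum.cong) (simp_all add: D_def C_def)
  have G: "G = 1 + fps_X * (fps_const ?X * G + G * C)"
  proof (rule fps_ext)
    fix r
    show "G $ r = (1 + fps_X * (fps_const ?X * G + G * C)) $ r"
      by (cases r) (simp_all add: GC, simp_all add: G_def map_poly_const_add h_sum
          map_poly_const_pCons_0 map_poly_const_smult)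
  qed
  have D: "D = fps_X * H + fps_X * (fps_const ?X * D + D * C)"
  proof (rule fps_ext)
    fix r
    show "D $ r = (fps_X * H + fps_X * (fps_const ?X * D + D * C)) $ r"
      by (cases r) (simp_all add: DC, simp_all add: D_def H_def
          nc_deriv_add nc_deriv_sum nc_deriv_smult nc_deriv_pCons_0)
  qed
  \<comment> \<open>Inserting \<open>1 = G - t (X + C) G\<close> and moving the factor onto
    \<open>D\<close> by commutativity takes the place of dividing by
    \<open>1 - t (X + C)\<close>.\<close>
  have "D = D * (G - fps_X * (fps_const ?X * G + G * C))"
    using G by (simp add: diff_eq_eq[symmetric])
  also have "\<dots> = G * (D - fps_X * (fps_const ?X * D + D * C))"
    by (simp add: algebra_simps)
  also have "D - fps_X * (fps_const ?X * D + D * C) = fps_X * H"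
    using D by (simp add: diff_eq_eq)
  finally have "D = fps_X * (G * H)" by (simp only: mult.left_commute)
  then have D_nth: "D $ r = (fps_X * (G * H)) $ r" by simp
  have GH: "(G * H) $ q = (\<Sum>k\<le>q. poly_tensor (resolvent_poly c k) (resolvent_poly c (q - k)))" for q
    by (simp add: fps_mult_nth G_def H_def poly_tensor_def atLeast0AtMost)
  show ?thesis
    using D_nth by (cases r) (simp_all add: GH lessThan_Suc_atMost, simp_all add: D_def)
qed

section \<open>Evaluation of derivatives in the Hilbert space tensor product\<close>

context nc_prob_space
begin

sublocale \<tau>: Vector_Spaces.linear "(*\<^sub>C)" "(*)" \<tau>
  by (rule linear)

end

lemma star_zero [simp]: "star (0 :: 'a::star_algebra_1) = 0"
  using star_scaleC[of 0 "0 :: 'a"] by simp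

lemma star_one [simp]: "star (1 :: 'a::star_algebra_1) = 1"
  by (metis mult_1_left star_mult star_star)

lemma star_power: "star x = x \<Longrightarrow> star (x ^ k) = x ^ k" for x :: "'a::star_algebra_1"
  by (induction k) (simp_all add: star_mult power_commutes)

lemma scaleC_power: "(c *\<^sub>C x) ^ k = c ^ k *\<^sub>C x ^ k" for x :: "'a::star_algebra_1"
  by (induction k) (simp_all add: scaleC_one scaleC_mult_left scaleC_mult_right scaleC_scaleC mult_ac)

locale L2_tensor = L2_completion \<tau> \<iota> + hilbert_tensor_product tens
  for \<tau> :: "'a::star_algebra_1 \<Rightarrow> complex"
    and \<iota> :: "'a \<Rightarrow> 'h::complex_hilbert_space"
    and tens :: "'h \<Rightarrow> 'h \<Rightarrow> 't::complex_hilbert_space"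
begin

sublocale \<iota>: Vector_Spaces.linear "(*\<^sub>C)" "(*\<^sub>C)" \<iota>
  by (rule linear_embedding)

sublocale tens_left: Vector_Spaces.linear "(*\<^sub>C)" "(*\<^sub>C)" "\<lambda>u. tens u v" for v
  by (rule linear_tens_left)

sublocale tens_right: Vector_Spaces.linear "(*\<^sub>C)" "(*\<^sub>C)" "\<lambda>v. tens u v" for u
  by (rule linear_tens_right)

definition elem :: "'a \<Rightarrow> 'a \<Rightarrow> 't" where
  "elem a b = tens (\<iota> a) (\<iota> b)"

lemma elem_add_left: "elem (a + a') b = elem a b + elem a' b"
  and elem_add_right: "elem a (b + b') = elem a b + elem a b'"
  and elem_scaleC_left: "elem (c *\<^sub>C a) b = c *\<^sub>C elem a b"
  and elem_scaleC_right: "elem a (c *\<^sub>C b) = c *\<^sub>C elem a b"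
  and elem_sum_left: "elem (sum f A) b = (\<Sum>i\<in>A. elem (f i) b)"
  and elem_sum_right: "elem a (sum g B) = (\<Sum>i\<in>B. elem a (g i))"
  by (simp_all add: elem_def \<iota>.add \<iota>.scale \<iota>.sum tens_left.add tens_right.add tens_left.scale
      tens_right.scale tens_left.sum tens_right.sum)

lemma cinner_elem: "cinner (elem a b) (elem a' b') = \<tau> (star a * a') * \<tau> (star b * b')"
  by (simp add: elem_def cinner_tens cinner_embedding)

lemma tensor_eval_altdef:
  assumes "degree Q \<le> n" "\<And>k. degree (coeff Q k) \<le> n"
  shows "tensor_eval \<iota> tens Q x = (\<Sum>k\<le>n. \<Sum>l\<le>n. coeff (coeff Q k) l *\<^sub>C elem (x ^ k) (x ^ l))"
proof -
  have "tensor_eval \<iota> tens Q x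
      = (\<Sum>k\<le>degree Q. \<Sum>l\<le>n. coeff (coeff Q k) l *\<^sub>C elem (x ^ k) (x ^ l))"
    unfolding tensor_eval_def elem_def
    by (intro sum.cong refl sum.mono_neutral_left) (use assms in \<open>auto simp: coeff_eq_0\<close>)
  also have "\<dots> = (\<Sum>k\<le>n. \<Sum>l\<le>n. coeff (coeff Q k) l *\<^sub>C elem (x ^ k) (x ^ l))"
    by (rule sum.mono_neutral_left) (use assms in \<open>auto simp: coeff_eq_0\<close>)
  finally show ?thesis .
qed

lemma degree_coeff_bounded: "\<exists>n\<ge>degree Q. \<forall>k. degree (coeff Q k) \<le> n"
  for Q :: "complex poly poly"
proof (intro exI conjI allI)
  let ?n = "degree Q + (\<Sum>k\<le>degree Q. degree (coeff Q k))"
  show "degree Q \<le> ?n" by simp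
  fix k
  show "degree (coeff Q k) \<le> ?n"
  proof (cases "k \<le> degree Q")
    case True
    then have "degree (coeff Q k) \<le> (\<Sum>k\<le>degree Q. degree (coeff Q k))"
      by (intro member_le_sum) auto
    then show ?thesis by simp
  qed (simp add: coeff_eq_0)
qed

lemma tensor_eval_add:
  "tensor_eval \<iota> tens (Q + Q') x = tensor_eval \<iota> tens Q x + tensor_eval \<iota> tens Q' x"
proof -
  obtain n n' where n: "degree Q \<le> n" "\<And>k. degree (coeff Q k) \<le> n"
    and n': "degree Q' \<le> n'" "\<And>k. degree (coeff Q' k) \<le> n'"
    using degree_coeff_bounded by metis
  let ?n = "max n n'"
  have "degree Q \<le> ?n" "degree Q' \<le> ?n" "degree (coeff Q k) \<le> ?n" "degree (coeff Q' k) \<le> ?n" for k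
    using n n' by (auto simp: le_max_iff_disj)
  then show ?thesis
    by (simp add: tensor_eval_altdef[of _ ?n] degree_add_le scaleC_add_left sum.distrib)
qed

lemma tensor_eval_smult: "tensor_eval \<iota> tens (smult [:c:] Q) x = c *\<^sub>C tensor_eval \<iota> tens Q x"
proof -
  obtain n where n: "degree Q \<le> n" "\<And>k. degree (coeff Q k) \<le> n"
    using degree_coeff_bounded by metis
  then show ?thesis
    by (simp add: tensor_eval_altdef[of _ n] order_trans[OF degree_smult_le]
        complex_vector.scale_sum_right scaleC_scaleC)
qed

lemma tensor_eval_0 [simp]: "tensor_eval \<iota> tens 0 x = 0"
  by (simp add: tensor_eval_def)

lemma tensor_eval_sum: "tensor_eval \<iota> tens (sum f A) x = (\<Sum>a\<in>A. tensor_eval \<iota> tens (f a) x)"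
  by (induction A rule: infinite_finite_induct) (simp_all add: tensor_eval_add)

lemma tensor_eval_pure_tensor: "tensor_eval \<iota> tens (pure_tensor k l) x = elem (x ^ k) (x ^ l)"
proof -
  let ?n = "max k l"
  have coeff_eq: "coeff (coeff (pure_tensor k l) i) j = (if j = l then if i = k then 1 else 0 else 0)" for i j
    by (simp add: pure_tensor_def)
  have "tensor_eval \<iota> tens (pure_tensor k l) x
      = (\<Sum>i\<le>?n. \<Sum>j\<le>?n. coeff (coeff (pure_tensor k l) i) j *\<^sub>C elem (x ^ i) (x ^ j))"
    by (rule tensor_eval_altdef) (auto simp: pure_tensor_def degree_monom_eq)
  also have "\<dots> = (\<Sum>i\<le>?n. \<Sum>j\<le>?n. if j = l then (if i = k then elem (x ^ k) (x ^ l) else 0) else 0)"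
    by (intro sum.cong refl) (simp add: coeff_eq scaleC_one)
  also have "\<dots> = elem (x ^ k) (x ^ l)"
    by (simp add: sum.delta)
  finally show ?thesis .
qed

lemma tensor_eval_poly_tensor:
  "tensor_eval \<iota> tens (poly_tensor P Q) x = elem (poly_eval P x) (poly_eval Q x)"
proof (induction P rule: poly_linear_induct)
  case (monom r)
  show ?case
  proof (induction Q rule: poly_linear_induct)
    case (monom s)
    show ?case by (simp add: pure_tensor_eq[symmetric] tensor_eval_pure_tensor scaleC_one)
  next
    case (add P Q)
    have "[:P + Q:] = [:P:] + [:Q:]" by simp
    with add show ?case
      by (simp only: poly_tensor_def distrib_left tensor_eval_add poly_eval.add elem_add_right)
  next
    case (smult c P)
    have "poly_tensor R (smult c P) = smult [:c:] (poly_tensor R P)" for R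
      by (simp add: poly_tensor_def)
    with smult show ?case
      by (simp only: tensor_eval_smult poly_eval.scale elem_scaleC_right)
  qed
next
  case (add P P')
  then show ?case
    by (simp only: poly_tensor_def map_poly_const_add distrib_right tensor_eval_add poly_eval.add
        elem_add_left)
next
  case (smult c P)
  then show ?case
    by (simp only: poly_tensor_def map_poly_const_smult mult_smult_left tensor_eval_smult
        poly_eval.scale elem_scaleC_left)
qed

definition deriv_eval :: "'a \<Rightarrow> complex poly \<Rightarrow> 't" where
  "deriv_eval x P = tensor_eval \<iota> tens (nc_deriv P) x"

lemma linear_deriv_eval: "Vector_Spaces.linear smult (*\<^sub>C) (deriv_eval x)"
  unfolding Vector_Spaces.linear_iff deriv_eval_def
  by (simp add: vector_space_poly complex_vector.vector_space_axioms nc_deriv_add tensor_eval_add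
      nc_deriv_smult tensor_eval_smult)

sublocale deriv_eval: Vector_Spaces.linear smult "(*\<^sub>C)" "deriv_eval x" for x
  by (rule linear_deriv_eval)

lemma deriv_eval_resolvent_poly:
  "deriv_eval x (resolvent_poly c r) = (\<Sum>k<r. elem (poly_eval (resolvent_poly c k) x)
     (poly_eval (resolvent_poly c (r - 1 - k)) x))"
  by (simp add: deriv_eval_def nc_deriv_resolvent_poly tensor_eval_sum tensor_eval_poly_tensor)

lemma deriv_eval_1 [simp]: "deriv_eval x 1 = 0"
  by (simp add: deriv_eval_def)

lemma deriv_eval_monom: "deriv_eval x (monom 1 r) = (\<Sum>k<r. elem (x ^ k) (x ^ (r - 1 - k)))"
  by (simp add: deriv_eval_def nc_deriv_monom tensor_eval_sum tensor_eval_pure_tensor)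

text \<open>On the monomial of degree \<open>r\<close>, scaling by \<open>l\<close> multiplies the
  left side by \<open>l ^ (r + 1)\<close> and the derivative by \<open>l ^ (r - 1)\<close>, so the
  same \<open>K\<close> works up to the factor \<open>l\<^sup>2\<close>.\<close>

lemma free_stein_kernel_scaled_iff:
  assumes "l \<noteq> 0" "star x = x" "\<tau> x = 0"
  shows "free_stein_kernel \<iota> tens (complex_of_real l *\<^sub>C x) K \<longleftrightarrow>
    (\<forall>P. complex_of_real (l\<^sup>2) * \<tau> (x * poly_eval P x) = cinner K (deriv_eval x P))"
proof -
  let ?l = "complex_of_real l"
  let ?A = "\<lambda>P. cinner (\<iota> (?l *\<^sub>C x)) (\<iota> (poly_eval P (?l *\<^sub>C x))) = cinner K (deriv_eval (?l *\<^sub>C x) P)"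
  let ?B = "\<lambda>P. complex_of_real (l\<^sup>2) * \<tau> (x * poly_eval P x) = cinner K (deriv_eval x P)"
  have A: "(\<forall>P. ?A P) \<longleftrightarrow> (\<forall>r. ?A (monom 1 r))"
  proof safe
    fix P assume *: "\<forall>r. ?A (monom 1 r)"
    show "?A P"
      by (induction P rule: poly_linear_induct)
        (rule *[rule_format], simp_all only: deriv_eval.add deriv_eval.scale poly_eval.add poly_eval.scale \<iota>.add \<iota>.scale
          cinner_add_right cinner_scaleC_right)
  qed blast
  have B: "(\<forall>P. ?B P) \<longleftrightarrow> (\<forall>r. ?B (monom 1 r))"
  proof safe
    fix P assume *: "\<forall>r. ?B (monom 1 r)"
    show "?B P"
      by (induction P rule: poly_linear_induct)
        (rule *[rule_format], simp_all only: deriv_eval.add deriv_eval.scale poly_eval.add poly_eval.scale \<tau>.add \<tau>.scale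
          distrib_left scaleC_mult_right mult.left_commute cinner_add_right cinner_scaleC_right)
  qed blast
  have "?A (monom 1 r) \<longleftrightarrow> ?B (monom 1 r)" for r
  proof (cases r)
    \<comment> \<open>Here the exponent \<open>r - 1\<close> makes no sense, but both sides vanish:
      \<open>x\<close> is centered and the derivative of 1 is 0.\<close>
    case 0
    then show ?thesis
      using assms by (simp add: deriv_eval_monom scaleC_one cinner_embedding star_scaleC \<tau>.scale del: \<iota>.scale)
  next
    case (Suc q)
    have "cinner (\<iota> (?l *\<^sub>C x)) (\<iota> (poly_eval (monom 1 r) (?l *\<^sub>C x))) = ?l ^ q * (?l\<^sup>2 * \<tau> (x * x ^ r))"
    proof -
      have "poly_eval (monom 1 r) (?l *\<^sub>C x) = ?l ^ r *\<^sub>C x ^ r"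
        by (simp only: poly_eval_monom scaleC_one scaleC_power)
      moreover have "star (?l *\<^sub>C x) = ?l *\<^sub>C x"
        by (simp add: star_scaleC assms)
      ultimately have "cinner (\<iota> (?l *\<^sub>C x)) (\<iota> (poly_eval (monom 1 r) (?l *\<^sub>C x)))
          = \<tau> ((?l * ?l ^ r) *\<^sub>C (x * x ^ r))"
        by (simp only: cinner_embedding scaleC_mult_left scaleC_mult_right scaleC_scaleC
            mult.commute[of ?l "?l ^ r"])
      then show ?thesis
        by (simp only: \<tau>.scale Suc) (simp add: power2_eq_square)
    qed
    moreover have "deriv_eval (?l *\<^sub>C x) (monom 1 r) = ?l ^ q *\<^sub>C deriv_eval x (monom 1 r)"
      unfolding deriv_eval_monom complex_vector.scale_sum_right
      by (rule sum.cong)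
        (auto simp: scaleC_power elem_scaleC_left elem_scaleC_right scaleC_scaleC Suc power_add[symmetric])
    ultimately show ?thesis
      using \<open>l \<noteq> 0\<close> by (simp add: cinner_scaleC_right scaleC_one)
  qed
  with A B show ?thesis
    by (simp only: free_stein_kernel_def deriv_eval_def)
qed

text \<open>On monomials, these inner products are sums of products of two moments, so they depend
  only on the law of the variable.\<close>

lemma cinner_deriv_eval_eq:
  assumes "star x = x" "star y = y" "\<And>r. \<tau> (x ^ r) = \<tau> (y ^ r)"
  shows "cinner (deriv_eval x P) (deriv_eval x Q) = cinner (deriv_eval y P) (deriv_eval y Q)"
proof (induction P rule: poly_linear_induct)
  case (monom r)
  show ?case
  proof (induction Q rule: poly_linear_induct)
    case (monom s)
    show ?case
      by (simp add: deriv_eval_monom cinner_sum_left cinner_sum_right cinner_elem star_power assms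
          power_add[symmetric])
  qed (simp_all add: deriv_eval.add deriv_eval.scale cinner_add_right cinner_scaleC_right)
qed (simp_all add: deriv_eval.add deriv_eval.scale cinner_add_left cinner_scaleC_left)

end

section \<open>Formal resolvents\<close>

text \<open>Embeds complex series as central elements of the power series ring over the
  algebra.\<close>

definition scalar_fps :: "complex fps \<Rightarrow> 'a::star_algebra_1 fps" where
  "scalar_fps f = Abs_fps (\<lambda>r. (f $ r) *\<^sub>C 1)"

lemma scalar_fps_nth [simp]: "scalar_fps f $ r = (f $ r) *\<^sub>C 1"
  by (simp add: scalar_fps_def)

lemma scalar_fps_mult_nth: "(scalar_fps f * A) $ r = (\<Sum>k\<le>r. (f $ k) *\<^sub>C (A $ (r - k)))"
  by (simp add: fps_mult_nth scaleC_mult_left atLeast0AtMost)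

lemma mult_scalar_fps_nth: "(A * scalar_fps f) $ r = (\<Sum>k\<le>r. (f $ (r - k)) *\<^sub>C (A $ k))"
  by (simp add: fps_mult_nth scaleC_mult_right atLeast0AtMost)

lemma scalar_fps_commute: "scalar_fps f * A = A * scalar_fps f"
proof (rule fps_ext)
  show "(scalar_fps f * A) $ r = (A * scalar_fps f) $ r" for r
    unfolding scalar_fps_mult_nth mult_scalar_fps_nth
    by (rule sum.reindex_bij_witness[of _ "\<lambda>k. r - k" "\<lambda>k. r - k"]) auto
qed

lemma scalar_fps_add: "scalar_fps (f + g) = scalar_fps f + scalar_fps g"
  by (rule fps_ext) (simp add: scaleC_add_left)

lemma scalar_fps_diff: "scalar_fps (f - g) = scalar_fps f - scalar_fps g"
  by (rule fps_ext) (simp add: complex_vector.scale_left_diff_distrib)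

lemma scalar_fps_1 [simp]: "scalar_fps 1 = 1"
  by (rule fps_ext) (simp add: scaleC_one)

lemma scalar_fps_0 [simp]: "scalar_fps 0 = 0"
  by (rule fps_ext) simp

lemma scalar_fps_of_nat [simp]: "scalar_fps (of_nat n) = of_nat n"
  by (induction n) (simp_all add: scalar_fps_add)

lemma scalar_fps_mult: "scalar_fps (f * g) = scalar_fps f * scalar_fps g"
  by (rule fps_ext)
    (simp add: fps_mult_nth scaleC_mult_left complex_vector.scale_sum_left atLeast0AtMost)

lemma scalar_fps_X [simp]: "scalar_fps fps_X = fps_X"
  by (rule fps_ext) (simp add: fps_X_def scaleC_one)

text \<open>Comparing coefficients in the equation of the formal resolvent of
  \<open>a + c(t)\<close> gives exactly the recursion of \<open>resolvent_poly\<close>. The equation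
  stands in for inverses of noncommutative series.\<close>

lemma fps_resolvent_iff:
  "E = 1 + fps_X * (fps_const a + scalar_fps c) * E
    \<longleftrightarrow> (\<forall>r. E $ r = poly_eval (resolvent_poly c r) a)" (is "?L \<longleftrightarrow> ?R")
proof -
  have rhs: "(1 + fps_X * (fps_const a + scalar_fps c) * E) $ 0 = 1"
    "(1 + fps_X * (fps_const a + scalar_fps c) * E) $ Suc r
      = a * E $ r + (\<Sum>k\<le>r. (c $ (r - k)) *\<^sub>C (E $ k))" for r
    by (simp_all add: mult.assoc distrib_right scalar_fps_commute mult_scalar_fps_nth)
  show ?thesis
  proof
    assume ?L
    then have E: "E $ r = (1 + fps_X * (fps_const a + scalar_fps c) * E) $ r" for r by simp
    show ?R
    proof
      fix r
      show "E $ r = poly_eval (resolvent_poly c r) a"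
      proof (induction r rule: less_induct)
        case (less r)
        show ?case
          by (subst E, cases r)
            (simp_all only: rhs, simp_all add: less poly_eval.add poly_eval.sum poly_eval.scale)
      qed
    qed
  next
    assume R: ?R
    show ?L
    proof (rule fps_ext)
      fix r
      show "E $ r = (1 + fps_X * (fps_const a + scalar_fps c) * E) $ r"
        by (cases r)
          (simp_all only: rhs, simp_all add: R poly_eval.add poly_eval.sum poly_eval.scale)
    qed
  qed
qed

section \<open>Existence of the subordination series\<close>

lemma resolvent_poly_cong:
  "(\<And>k. k < r \<Longrightarrow> c $ k = c' $ k) \<Longrightarrow> resolvent_poly c r = resolvent_poly c' r"
proof (induction r rule: less_induct)
  case (less r)
  show ?case
  proof (cases r)
    case (Suc q)
    have "resolvent_poly c a = resolvent_poly c' a" if "a \<le> q" for a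
      using less Suc that by simp
    moreover have "c $ (q - a) = c' $ (q - a)" if "a \<le> q" for a
      using less(2) Suc by simp
    ultimately show ?thesis using Suc by simp
  qed simp
qed

text \<open>Recursive solution of a triangular system: \<open>resolvent_poly c r\<close> uses only
  coefficients of \<open>c\<close> below \<open>r\<close>, so the series truncated at
  \<open>r\<close> determines the next coefficient.\<close>

function subordination_coeff :: "(complex poly \<Rightarrow> complex) \<Rightarrow> complex \<Rightarrow> nat \<Rightarrow> complex" where
  "subordination_coeff L \<nu> r =
     (let c = Abs_fps (\<lambda>k. if k < r then subordination_coeff L \<nu> k else 0)
      in \<nu> * L (pCons 0 (resolvent_poly c r)) - (\<Sum>a=1..r. c $ (r - a) * L (resolvent_poly c a)))"
  by auto
termination by (relation "Wellfounded.measure (\<lambda>(L, \<nu>, r). r)") auto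

declare subordination_coeff.simps [simp del]

lemma subordination_coeff_exists:
  assumes "L 1 = 1"
  obtains c :: "complex fps" where
    "\<And>r. (\<Sum>a\<le>r. c $ (r - a) * L (resolvent_poly c a)) = \<nu> * L (pCons 0 (resolvent_poly c r))"
proof
  define c where "c = Abs_fps (subordination_coeff L \<nu>)"
  fix r
  define d where "d = Abs_fps (\<lambda>k. if k < r then subordination_coeff L \<nu> k else 0)"
  have d: "resolvent_poly d a = resolvent_poly c a" if "a \<le> r" for a
    using that by (intro resolvent_poly_cong) (simp add: c_def d_def)
  have "c $ r = \<nu> * L (pCons 0 (resolvent_poly d r)) - (\<Sum>a=1..r. d $ (r - a) * L (resolvent_poly d a))"
    by (simp add: c_def d_def subordination_coeff.simps[of L \<nu> r] Let_def)
  also have "\<dots> = \<nu> * L (pCons 0 (resolvent_poly c r)) - (\<Sum>a=1..r. c $ (r - a) * L (resolvent_poly c a))"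
    using d by (simp add: c_def d_def)
  finally have "c $ r + (\<Sum>a=1..r. c $ (r - a) * L (resolvent_poly c a)) = \<nu> * L (pCons 0 (resolvent_poly c r))"
    by simp
  moreover have "{..r} = insert 0 {1..r}" by auto
  \<comment> \<open>The term \<open>a = 0\<close> is \<open>c $ r\<close>, because
    \<open>L 1 = 1\<close>.\<close>
  ultimately show "(\<Sum>a\<le>r. c $ (r - a) * L (resolvent_poly c a)) = \<nu> * L (pCons 0 (resolvent_poly c r))"
    using assms by simp
qed

section \<open>Reduced words\<close>

lemma unital_star_subalgebra_generated: "unital_star_subalgebra (generated_star_subalgebra S)"
  unfolding generated_star_subalgebra_def unital_star_subalgebra_def by blast

lemma generated_star_subalgebra_superset: "S \<subseteq> generated_star_subalgebra S"
  unfolding generated_star_subalgebra_def by blast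

lemma unital_star_subalgebra_subspace:
  assumes "unital_star_subalgebra A" shows "complex_vector.subspace A"
proof -
  have "0 *\<^sub>C 1 \<in> A" using assms unfolding unital_star_subalgebra_def by blast
  then show ?thesis
    using assms unfolding unital_star_subalgebra_def complex_vector.subspace_def by auto
qed

lemma poly_eval_in_subalgebra:
  assumes "unital_star_subalgebra A" "a \<in> A" shows "poly_eval P a \<in> A"
proof -
  have "a ^ k \<in> A" for k
    using assms by (induction k) (auto simp: unital_star_subalgebra_def)
  then show ?thesis
    unfolding poly_eval_def
    by (intro complex_vector.subspace_sum complex_vector.subspace_scale
        unital_star_subalgebra_subspace assms)
qed

locale free_family = nc_prob_space \<tau> for \<tau> :: "'a::star_algebra_1 \<Rightarrow> complex" +
  fixes x :: "'i \<Rightarrow> 'a"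
  assumes free: "free_variables \<tau> x"
begin

definition centered :: "'i \<Rightarrow> 'a set" where
  "centered i = {a \<in> generated_star_subalgebra {x i}. \<tau> a = 0}"

definition word_products :: "'i list \<Rightarrow> 'a set" where
  "word_products w = {prod_list as | as. list_all2 (\<lambda>a i. a \<in> centered i) as w}"

lemma word_products_Nil [simp]: "word_products [] = {1}"
  by (auto simp: word_products_def)

lemma word_products_Cons: "word_products (i # w) = {a * u | a u. a \<in> centered i \<and> u \<in> word_products w}"
  unfolding word_products_def by (auto simp: list_all2_Cons2) (metis prod_list.Cons)+

lemma word_products_append:
  "u \<in> word_products v \<Longrightarrow> u' \<in> word_products w \<Longrightarrow> u * u' \<in> word_products (v @ w)"
  unfolding word_products_def
  by clarsimp (metis list_all2_appendI prod_list.append)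

lemma star_centered: "a \<in> centered i \<Longrightarrow> star a \<in> centered i"
  using unital_star_subalgebra_generated[of "{x i}"]
  by (simp add: centered_def trace_star unital_star_subalgebra_def)

lemma star_word_products: "u \<in> word_products w \<Longrightarrow> star u \<in> word_products (rev w)"
proof (induction w arbitrary: u)
  case (Cons i w)
  then obtain a u' where u: "u = a * u'" "a \<in> centered i" "u' \<in> word_products w"
    by (auto simp: word_products_Cons)
  then have "star u' * star a \<in> word_products (rev w @ [i])"
    by (intro word_products_append) (auto simp: Cons.IH word_products_Cons star_centered)
  then show ?case by (simp add: u star_mult)
qed simp

text \<open>Freeness in the language of lists; \<open>distinct_adj\<close> singles out the reduced
  words.\<close>

lemma trace_word_products:
  assumes "distinct_adj w" "w \<noteq> []" "u \<in> word_products w"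
  shows "\<tau> u = 0"
proof -
  obtain as where u: "u = prod_list as" and as: "list_all2 (\<lambda>a i. a \<in> centered i) as w"
    using assms(3) by (auto simp: word_products_def)
  have "length as = length w" using as by (rule list_all2_lengthD)
  have "\<tau> (prod_list (map ((!) as) [0..<length w])) = 0"
    using free unfolding free_variables_def free_subalgebras_def
  proof (elim allE[of _ "length w"] impE allE[of _ "(!) w"] allE[of _ "(!) as"])
    show "1 \<le> length w" using assms(2) by (simp add: Suc_leI)
    show "\<forall>j<length w. as ! j \<in> generated_star_subalgebra {x (w ! j)} \<and> \<tau> (as ! j) = 0"
      using as by (simp add: list_all2_conv_all_nth centered_def)
    show "\<forall>j. Suc j < length w \<longrightarrow> w ! j \<noteq> w ! Suc j"
      using assms(1) by (simp add: distinct_adj_conv_nth)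
  qed
  then show ?thesis using u \<open>length as = length w\<close> by (metis map_nth)
qed

text \<open>If the first letters differ, \<open>star u * v\<close> is a product over a reduced word
  and has trace 0. If they agree, the two adjacent factors merge into a centered element plus a
  scalar: the former gives a reduced word again, the latter is covered by induction on the
  tails.\<close>

lemma word_products_orthogonal:
  assumes "distinct_adj w" "distinct_adj w'" "w \<noteq> w'" "u \<in> word_products w" "v \<in> word_products w'"
  shows "\<tau> (star u * v) = 0"
  using assms
proof (induction w arbitrary: w' u v)
  case Nil
  then show ?case by (simp add: trace_word_products)
next
  case (Cons i p)
  show ?case
  proof (cases w')
    case Nil
    then show ?thesis using Cons.prems by (simp add: trace_star trace_word_products)
  next
    case (Cons j q)
    obtain a u' where u: "u = a * u'" "a \<in> centered i" "u' \<in> word_products p"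
      using Cons.prems by (auto simp: word_products_Cons)
    obtain b v' where v: "v = b * v'" "b \<in> centered j" "v' \<in> word_products q"
      using Cons.prems Cons by (auto simp: word_products_Cons)
    show ?thesis
    proof (cases "i = j")
      case False
      have "star u * v \<in> word_products (rev (i # p) @ w')"
        using Cons.prems by (intro word_products_append star_word_products)
      moreover have "distinct_adj (rev (i # p) @ w')"
        using Cons.prems False Cons by (simp add: distinct_adj_append_iff del: rev.simps) simp
      ultimately show ?thesis by (rule trace_word_products[rotated 2]) auto
    next
      case True
      define c where "c = star a * b - \<tau> (star a * b) *\<^sub>C 1"
      have "star a * b - \<tau> (star a * b) *\<^sub>C 1 \<in> generated_star_subalgebra {x i}"
        using u v True unital_star_subalgebra_generated[of "{x i}"]
        by (intro complex_vector.subspace_diff unital_star_subalgebra_subspace)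
          (auto simp: unital_star_subalgebra_def centered_def)
      then have "c \<in> centered i"
        by (simp add: centered_def c_def \<tau>.diff \<tau>.scale trace_one)
      then have "c * v' \<in> word_products (i # q)"
        using v by (auto simp: word_products_Cons)
      then have "star u' * (c * v') \<in> word_products (rev p @ i # q)"
        using u by (intro word_products_append star_word_products)
      moreover have "distinct_adj (rev p @ i # q)"
        using Cons.prems(1,2) Cons True
        by (auto simp: distinct_adj_append_iff distinct_adj_Cons last_rev)
      ultimately have "\<tau> (star u' * (c * v')) = 0"
        by (rule trace_word_products[rotated 2]) auto
      moreover have "\<tau> (star u' * v') = 0"
        using Cons.prems(1-3) Cons True u v by (intro Cons.IH[of q]) (auto dest: distinct_adj_ConsD)
      moreover have "star u * v = star u' * (c * v') + \<tau> (star a * b) *\<^sub>C (star u' * v')"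
        by (simp add: u v c_def star_mult algebra_simps scaleC_mult_left scaleC_mult_right)
      ultimately show ?thesis by (simp add: \<tau>.add \<tau>.scale)
    qed
  qed
qed

text \<open>For reduced \<open>w\<close> these are the orthogonal summands of the free product
  decomposition; the empty word gives the scalars.\<close>

definition word_space :: "'i list \<Rightarrow> 'a set" where
  "word_space w = complex_vector.span (word_products w)"

lemma subspace_word_space: "complex_vector.subspace (word_space w)"
  by (simp add: word_space_def)

lemma word_products_subset: "word_products w \<subseteq> word_space w"
  by (simp add: word_space_def complex_vector.span_superset)

lemma word_space_orthogonal:
  assumes "distinct_adj w" "distinct_adj w'" "w \<noteq> w'" "u \<in> word_space w" "v \<in> word_space w'"
  shows "\<tau> (star u * v) = 0"
proof -
  have "\<tau> (star u * v) = 0" if "u \<in> word_products w" for u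
    using assms(5) unfolding word_space_def
    by (induction rule: complex_vector.span_induct)
      (use assms that in \<open>auto simp: complex_vector.subspace_def distrib_left scaleC_mult_right \<tau>.add \<tau>.scale
        intro: word_products_orthogonal\<close>)
  with assms(4) show ?thesis unfolding word_space_def
    by (induction rule: complex_vector.span_induct)
      (auto simp: complex_vector.subspace_def star_add star_scaleC
        distrib_right scaleC_mult_left \<tau>.add \<tau>.scale)
qed

lemma trace_word_space: "distinct_adj w \<Longrightarrow> w \<noteq> [] \<Longrightarrow> u \<in> word_space w \<Longrightarrow> \<tau> u = 0"
  using word_space_orthogonal[of "[]" w 1 u] word_products_subset[of "[]"] by simp

lemma word_space_Cons:
  assumes "a \<in> centered i" "u \<in> word_space w" shows "a * u \<in> word_space (i # w)"
  using assms(2) unfolding word_space_def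
proof (induction rule: complex_vector.span_induct)
  show "complex_vector.subspace {u. a * u \<in> complex_vector.span (word_products (i # w))}"
    by (auto simp: complex_vector.subspace_def distrib_left scaleC_mult_right
        intro: complex_vector.span_add complex_vector.span_scale complex_vector.span_zero)
  show "a * u \<in> complex_vector.span (word_products (i # w))" if "u \<in> word_products w" for u
    using that assms(1) by (intro complex_vector.span_base) (auto simp: word_products_Cons)
qed

end

section \<open>Resolvents of free sums\<close>

text \<open>Here \<open>g(t) = \<tau>((1 - t s\<^sub>n)\<^sup>-\<^sup>1)\<close>, and \<open>c\<close> is the series with \<open>E\<^sub>i (1 - t s\<^sub>n)\<^sup>-\<^sup>1 = (1 - t (x\<^sub>i + c(t)))\<^sup>-\<^sup>1\<close>.
  The last two assumptions amount to \<open>n t c g = (n - 1) (g - 1)\<close>, which is the equation \<open>n \<omega> - w = (n - 1) / G\<close>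
  for the subordination function \<open>\<omega> = (1 - t c) / t\<close> at \<open>w = 1 / t\<close>, where \<open>G = t g\<close>.\<close>

locale subordination = free_family \<tau> x
  for \<tau> :: "'a::star_algebra_1 \<Rightarrow> complex" and x :: "'i \<Rightarrow> 'a" +
  fixes n :: nat and c g h :: "complex fps"
  assumes trace_resolvent: "\<And>i r. \<tau> (poly_eval (resolvent_poly c r) (x i)) = g $ r"
    and c_mult_g: "c * g = (of_nat n - 1) * h"
    and g_eq: "g = 1 + fps_X * (of_nat n * h)"
begin

definition res :: "'i \<Rightarrow> 'a fps" where
  "res i = Abs_fps (\<lambda>r. poly_eval (resolvent_poly c r) (x i))"

text \<open>The resolvent of \<open>x i\<close> divided by its trace series \<open>g\<close>, minus
  1, hence centered.\<close>

definition dev :: "'i \<Rightarrow> 'a fps" where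
  "dev i = res i * scalar_fps (inverse g) - 1"

definition word_fps :: "'i list \<Rightarrow> 'a fps" where
  "word_fps w = prod_list (map dev w)"

definition words :: "'i set \<Rightarrow> nat \<Rightarrow> 'i list set" where
  "words S N = {w. set w \<subseteq> S \<and> distinct_adj w \<and> length w \<le> N}"

text \<open>The sum over all reduced words over \<open>S\<close>; words longer than \<open>r\<close>
  do not reach the coefficient \<open>r\<close>.\<close>

definition words_sum :: "'i set \<Rightarrow> 'a fps" where
  "words_sum S = Abs_fps (\<lambda>r. \<Sum>w\<in>words S r. word_fps w $ r)"

definition words_sum_hd :: "'i set \<Rightarrow> 'i \<Rightarrow> 'a fps" where
  "words_sum_hd S i = Abs_fps (\<lambda>r. \<Sum>w | w \<in> words S r \<and> w \<noteq> [] \<and> hd w = i. word_fps w $ r)"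

text \<open>The part of the resolvent of \<open>s\<^sub>n\<close> in \<open>word_space w\<close>. It
  involves no set \<open>S\<close>, so passing to fewer variables merely drops words.\<close>

definition component :: "'i list \<Rightarrow> 'a fps" where
  "component w = scalar_fps g * word_fps w"

text \<open>The scalar shift that remains after conditioning on \<open>m\<close> of the
  \<open>n\<close> variables: \<open>c\<close> for \<open>m = 1\<close> and 0 for
  \<open>m = n\<close>.\<close>

definition coeff_sub :: "nat \<Rightarrow> complex fps" where
  "coeff_sub m = (of_nat n - of_nat m) * h * inverse g"

lemma g_mult_inverse [simp]: "g * inverse g = 1" "inverse g * g = 1"
proof -
  have "g $ 0 \<noteq> 0" using trace_resolvent[of 0] by (simp add: trace_one)
  then show "g * inverse g = 1" "inverse g * g = 1"
    by (simp_all add: inverse_mult_eq_1 inverse_mult_eq_1')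
qed

lemma res_eq: "res i = scalar_fps g * (1 + dev i)"
proof -
  have "scalar_fps g * (1 + dev i) = (1 + dev i) * scalar_fps g"
    by (rule scalar_fps_commute)
  also have "\<dots> = res i * scalar_fps (inverse g * g)"
    unfolding dev_def scalar_fps_mult mult.assoc[symmetric] by simp
  finally show ?thesis by simp
qed

lemma dev_centered: "dev i $ r \<in> centered i"
proof -
  let ?A = "generated_star_subalgebra {x i}"
  have A: "unital_star_subalgebra ?A" by (rule unital_star_subalgebra_generated)
  have "x i \<in> ?A" using generated_star_subalgebra_superset by blast
  have one: "(1 :: 'a fps) $ r \<in> ?A"
    using A complex_vector.subspace_0[OF unital_star_subalgebra_subspace[OF A]]
    by (cases r) (auto simp: unital_star_subalgebra_def)
  have "dev i $ r \<in> ?A"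
    unfolding dev_def fps_sub_nth mult_scalar_fps_nth
    by (intro complex_vector.subspace_diff complex_vector.subspace_sum complex_vector.subspace_scale
        unital_star_subalgebra_subspace A one)
      (simp add: res_def poly_eval_in_subalgebra A \<open>x i \<in> ?A\<close>)
  moreover have "\<tau> (dev i $ r) = 0"
  proof -
    have "\<tau> ((res i * scalar_fps (inverse g)) $ r) = (\<Sum>k\<le>r. g $ k * inverse g $ (r - k))"
      by (simp add: mult_scalar_fps_nth \<tau>.sum \<tau>.scale res_def trace_resolvent mult.commute)
    also have "\<dots> = (g * inverse g) $ r" by (simp only: fps_mult_nth atLeast0AtMost)
    also have "\<dots> = \<tau> ((1 :: 'a fps) $ r)" by (simp add: trace_one)
    finally show ?thesis by (simp add: dev_def \<tau>.diff)
  qed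
  ultimately show ?thesis by (simp add: centered_def)
qed

lemma word_fps_Nil [simp]: "word_fps [] = 1"
  by (simp add: word_fps_def)

lemma word_fps_Cons: "word_fps (i # w) = dev i * word_fps w"
  by (simp add: word_fps_def)

text \<open>Each \<open>dev i\<close> has constant term 0, so every letter raises the order by at
  least one.\<close>

lemma word_fps_nth_eq_0: "r < length w \<Longrightarrow> word_fps w $ r = 0"
proof (induction w arbitrary: r)
  case (Cons i w)
  have "dev i $ 0 = 0"
    using trace_resolvent[of 0] by (simp add: dev_def res_def trace_one scaleC_one)
  have "dev i $ k * word_fps w $ (r - k) = 0" if "k \<le> r" for k
  proof (cases k)
    case (Suc k')
    then have "word_fps w $ (r - k) = 0" using Cons.prems that by (intro Cons.IH) auto
    then show ?thesis by simp
  qed (simp add: \<open>dev i $ 0 = 0\<close>)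
  then show ?case by (simp add: word_fps_Cons fps_mult_nth)
qed simp

lemma word_fps_in_word_space: "word_fps w $ r \<in> word_space w"
proof (induction w arbitrary: r)
  case Nil
  then show ?case
    using word_products_subset[of "[]"] complex_vector.subspace_0[OF subspace_word_space]
    by (cases r) auto
next
  case (Cons i w)
  then show ?case
    unfolding word_fps_Cons fps_mult_nth
    by (intro complex_vector.subspace_sum subspace_word_space word_space_Cons dev_centered) auto
qed

lemma component_in_word_space: "component w $ r \<in> word_space w"
  unfolding component_def scalar_fps_mult_nth
  by (intro complex_vector.subspace_sum complex_vector.subspace_scale subspace_word_space
      word_fps_in_word_space)

lemma component_Nil_nth: "component [] $ r = (g $ r) *\<^sub>C 1"
  by (simp add: component_def)

section \<open>Sums over reduced words as resolvents\<close>

lemma finite_words: "finite S \<Longrightarrow> finite (words S N)"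
  by (rule finite_subset[OF _ finite_lists_length_le[of S N]]) (auto simp: words_def)

lemma words_sum_nth:
  assumes "finite S" "r \<le> N"
  shows "words_sum S $ r = (\<Sum>w\<in>words S N. word_fps w $ r)"
  unfolding words_sum_def fps_nth_Abs_fps
  by (rule sum.mono_neutral_left[OF finite_words[OF assms(1)]])
    (use assms(2) in \<open>auto simp: words_def intro: word_fps_nth_eq_0\<close>)

lemma words_sum_hd_nth:
  assumes "finite S" "r \<le> N"
  shows "words_sum_hd S i $ r = (\<Sum>w | w \<in> words S N \<and> w \<noteq> [] \<and> hd w = i. word_fps w $ r)"
  unfolding words_sum_hd_def fps_nth_Abs_fps
  by (rule sum.mono_neutral_left[OF finite_subset[OF _ finite_words[OF assms(1), of N]]])
    (use assms(2) in \<open>auto simp: words_def intro: word_fps_nth_eq_0\<close>)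

lemma words_sum_eq:
  assumes "finite S" shows "words_sum S = 1 + (\<Sum>i\<in>S. words_sum_hd S i)"
proof (rule fps_ext)
  fix r
  let ?W = "\<lambda>i. {w. w \<in> words S r \<and> w \<noteq> [] \<and> hd w = i}"
  have fin: "finite (\<Union>i\<in>S. ?W i)"
    using assms finite_words[OF assms] by auto
  have "words S r = insert [] (\<Union>i\<in>S. ?W i)"
    by (auto simp: words_def) (metis hd_in_set subsetD)
  then have "(\<Sum>w\<in>words S r. word_fps w $ r) = (\<Sum>w\<in>insert [] (\<Union>i\<in>S. ?W i). word_fps w $ r)"
    by (rule arg_cong)
  also have "\<dots> = word_fps [] $ r + (\<Sum>w\<in>(\<Union>i\<in>S. ?W i). word_fps w $ r)"
    using fin by (intro sum.insert) auto
  also have "(\<Sum>w\<in>(\<Union>i\<in>S. ?W i). word_fps w $ r) = (\<Sum>i\<in>S. \<Sum>w\<in>?W i. word_fps w $ r)"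
    using assms finite_words[OF assms] by (intro sum.UNION_disjoint) auto
  finally show "words_sum S $ r = (1 + (\<Sum>i\<in>S. words_sum_hd S i)) $ r"
    by (simp only: words_sum_def words_sum_hd_def fps_sum_nth fps_nth_Abs_fps fps_add_nth word_fps_Nil)
qed

lemma words_sum_hd_eq:
  assumes "finite S" "i \<in> S"
  shows "words_sum_hd S i = dev i * (words_sum S - words_sum_hd S i)"
proof (rule fps_ext)
  fix r
  let ?V = "{v \<in> words S r. v = [] \<or> hd v \<noteq> i}"
  have rest: "(words_sum S - words_sum_hd S i) $ q = (\<Sum>v\<in>?V. word_fps v $ q)" if "q \<le> r" for q
  proof -
    have "words S r = ?V \<union> {w. w \<in> words S r \<and> w \<noteq> [] \<and> hd w = i}" by auto
    then have "(\<Sum>w\<in>words S r. word_fps w $ q)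
        = (\<Sum>v\<in>?V. word_fps v $ q) + (\<Sum>w | w \<in> words S r \<and> w \<noteq> [] \<and> hd w = i. word_fps w $ q)"
      using finite_words[OF assms(1)] by (subst sum.union_disjoint[symmetric]) auto
    then show ?thesis
      by (simp add: words_sum_nth[OF assms(1) that] words_sum_hd_nth[OF assms(1) that])
  qed
  \<comment> \<open>The bound \<open>Suc r\<close> leaves tails of length at most \<open>r\<close>,
    so removing the first letter maps these words onto \<open>?V\<close>.\<close>
  have "words_sum_hd S i $ r
      = (\<Sum>w | w \<in> words S (Suc r) \<and> w \<noteq> [] \<and> hd w = i. word_fps w $ r)"
    using assms by (intro words_sum_hd_nth) auto
  also have "\<dots> = (\<Sum>v\<in>?V. word_fps (i # v) $ r)"
    by (rule sum.reindex_bij_witness[of _ "\<lambda>v. i # v" tl])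
      (use assms in \<open>auto simp: words_def distinct_adj_Cons neq_Nil_conv\<close>)
  also have "\<dots> = (\<Sum>k=0..r. dev i $ k * (\<Sum>v\<in>?V. word_fps v $ (r - k)))"
    unfolding word_fps_Cons fps_mult_nth sum_distrib_left by (rule sum.swap)
  also have "\<dots> = (dev i * (words_sum S - words_sum_hd S i)) $ r"
    unfolding fps_mult_nth by (intro sum.cong refl) (simp only: rest diff_le_self)
  finally show "words_sum_hd S i $ r = (dev i * (words_sum S - words_sum_hd S i)) $ r" .
qed

text \<open>The identity \<open>(1 - \<Sum>\<^sub>i d\<^sub>i / (1 + d\<^sub>i)) \<Sum>\<^sub>w d\<^sub>w = 1\<close>, for the sum over alternating words \<open>w\<close> and
  \<open>d\<^sub>i = dev i\<close>, turns the sum of words into a resolvent, because \<open>t x\<^sub>i = 1 - t c - 1 / (g (1 + d\<^sub>i))\<close>.\<close>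

lemma resolvent_sum:
  assumes "finite S"
  defines "E \<equiv> scalar_fps g * words_sum S"
  shows "E = 1 + fps_X * (fps_const (\<Sum>i\<in>S. x i) + scalar_fps (coeff_sub (card S))) * E"
proof -
  let ?B = "words_sum S"
  \<comment> \<open>With \<open>m = card S\<close>, all scalar terms become multiples of
    \<open>D\<close>: \<open>E = ?B + n D\<close>, and the shift contributes
    \<open>(n - m) D\<close>. The variables contribute \<open>?B - 1 + m D\<close>, so
    \<open>m\<close> cancels.\<close>
  define D where "D = fps_X * scalar_fps h * ?B"
  have G: "scalar_fps g = 1 + of_nat n * (fps_X * scalar_fps h)"
    by (subst g_eq) (simp add: scalar_fps_add scalar_fps_mult mult_of_nat_commute mult.assoc)
  have E_D: "E = ?B + of_nat n * D"
    unfolding E_def D_def G by (simp add: distrib_right mult.assoc)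
  have scalar_E: "fps_X * scalar_fps f * E = scalar_fps z * D" if "f * g = z * h" for f z
  proof -
    have "fps_X * scalar_fps f * E = fps_X * scalar_fps (f * g) * ?B"
      by (simp add: E_def scalar_fps_mult mult.assoc)
    also have "\<dots> = fps_X * scalar_fps z * scalar_fps h * ?B"
      by (simp add: that scalar_fps_mult mult.assoc)
    also have "\<dots> = scalar_fps z * D"
      by (simp add: D_def fps_mult_fps_X_commute mult.assoc)
    finally show ?thesis .
  qed
  have c_E: "fps_X * scalar_fps c * E = of_nat n * D - D"
    using scalar_E[OF c_mult_g] by (simp add: scalar_fps_diff left_diff_distrib)
  have "coeff_sub (card S) * g = (of_nat n - of_nat (card S)) * h"
    by (simp add: coeff_sub_def mult.assoc)
  from scalar_E[OF this]
  have sub_E: "fps_X * scalar_fps (coeff_sub (card S)) * E = of_nat n * D - of_nat (card S) * D"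
    by (simp add: scalar_fps_diff left_diff_distrib)
  \<comment> \<open>By \<open>words_sum_hd_eq\<close>, \<open>res i\<close> times the sum over words
    not starting with \<open>i\<close> is \<open>E\<close>; the resolvent equation of
    \<open>res i\<close> is then solved for the term with \<open>x i\<close>.\<close>
  have x_E: "fps_X * fps_const (x i) * E = words_sum_hd S i + D" if "i \<in> S" for i
  proof -
    let ?R = "?B - words_sum_hd S i"
    have "res i * ?R = scalar_fps g * (?R + dev i * ?R)"
      unfolding res_eq by (simp only: mult.assoc distrib_right mult_1_left)
    also have "\<dots> = E"
      by (simp only: words_sum_hd_eq[OF assms(1) that, symmetric] E_def) simp
    finally have R: "res i * ?R = E" .
    have "res i = 1 + fps_X * (fps_const (x i) + scalar_fps c) * res i"
      by (subst fps_resolvent_iff) (simp add: res_def)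
    then have "res i * ?R = ?R + fps_X * (fps_const (x i) + scalar_fps c) * (res i * ?R)"
      by (metis distrib_right mult.assoc mult_1_left)
    then have "E = ?R + (fps_X * fps_const (x i) * E + fps_X * scalar_fps c * E)"
      unfolding R by (simp only: distrib_left distrib_right)
    then show ?thesis using E_D unfolding c_E by (simp add: algebra_simps)
  qed
  have "fps_X * fps_const (\<Sum>i\<in>S. x i) * E = (\<Sum>i\<in>S. fps_X * fps_const (x i) * E)"
  proof -
    have "fps_const (\<Sum>i\<in>S. x i) = (\<Sum>i\<in>S. fps_const (x i))"
      by (rule fps_ext) (simp add: fps_sum_nth)
    then show ?thesis by (simp add: sum_distrib_left sum_distrib_right)
  qed
  also have "\<dots> = ?B - 1 + of_nat (card S) * D"
    by (simp add: x_E sum.distrib words_sum_eq[OF assms(1)])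
  finally have "fps_X * (fps_const (\<Sum>i\<in>S. x i) + scalar_fps (coeff_sub (card S))) * E
      = (?B - 1 + of_nat (card S) * D) + (of_nat n * D - of_nat (card S) * D)"
    by (simp only: distrib_left distrib_right sub_E)
  then show ?thesis using E_D by simp
qed

lemma sum_components:
  assumes "finite S" "r \<le> N"
  shows "(\<Sum>w\<in>words S N. component w $ r)
    = poly_eval (resolvent_poly (coeff_sub (card S)) r) (\<Sum>i\<in>S. x i)"
proof -
  have "(\<Sum>w\<in>words S N. component w $ r) = (scalar_fps g * words_sum S) $ r"
  proof -
    have "words_sum S $ (r - k) = (\<Sum>w\<in>words S N. word_fps w $ (r - k))" for k
      by (rule words_sum_nth) (use assms in auto)
    then show ?thesis
      unfolding component_def scalar_fps_mult_nth
      by (subst sum.swap) (simp add: complex_vector.scale_sum_right)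
  qed
  also have "\<dots> = poly_eval (resolvent_poly (coeff_sub (card S)) r) (\<Sum>i\<in>S. x i)"
    using resolvent_sum[OF assms(1)] by (simp only: fps_resolvent_iff)
  finally show ?thesis .
qed

lemma coeff_sub_self [simp]: "coeff_sub n = 0"
  by (simp add: coeff_sub_def)

lemma sum_components_power:
  assumes "finite S" "card S = n" "r \<le> N"
  shows "(\<Sum>w\<in>words S N. component w $ r) = (\<Sum>i\<in>S. x i) ^ r"
  using sum_components[OF assms(1,3)] assms(2) by (simp add: resolvent_poly_0 scaleC_one)

lemma trace_component: "distinct_adj w \<Longrightarrow> w \<noteq> [] \<Longrightarrow> \<tau> (component w $ r) = 0"
  by (rule trace_word_space[OF _ _ component_in_word_space])

text \<open>Only the empty word has nonzero trace, so \<open>g\<close> is the moment series of a sum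
  of \<open>n\<close> of the variables.\<close>

lemma trace_power_sum:
  assumes "finite S" "card S = n"
  shows "\<tau> ((\<Sum>i\<in>S. x i) ^ r) = g $ r"
proof -
  have "\<tau> ((\<Sum>i\<in>S. x i) ^ r) = (\<Sum>w\<in>words S r. \<tau> (component w $ r))"
    by (simp add: sum_components_power[OF assms order_refl, symmetric] \<tau>.sum)
  also have "\<dots> = (\<Sum>w\<in>{[]}. \<tau> (component w $ r))"
    by (rule sum.mono_neutral_right[OF finite_words[OF assms(1)]])
      (auto simp: words_def trace_component)
  finally show ?thesis by (simp add: component_Nil_nth \<tau>.scale trace_one)
qed

end

text \<open>The triangular system is solved with the common law of the variables as \<open>L\<close>
  and \<open>n - 1\<close> as \<open>\<nu>\<close>.\<close>

lemma subordination_exists: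
  assumes "free_family \<tau> x" "identically_distributed \<tau> x"
  obtains c g h where "subordination \<tau> x n c g h"
proof -
  interpret free_family \<tau> x by fact
  define L where "L P = \<tau> (poly_eval P (x undefined))" for P
  have law: "\<tau> (poly_eval P (x i)) = L P" for P i
  proof -
    have "\<tau> (x i ^ r) = \<tau> (x undefined ^ r)" for r
      using assms(2) by (cases r) (auto simp: identically_distributed_def simp del: power_Suc)
    then show ?thesis by (simp add: L_def poly_eval_def \<tau>.sum \<tau>.scale)
  qed
  have L_1: "L 1 = 1" by (simp add: L_def trace_one)
  obtain c where c: "\<And>r. (\<Sum>a\<le>r. c $ (r - a) * L (resolvent_poly c a))
      = (of_nat n - 1) * L (pCons 0 (resolvent_poly c r))"
    using subordination_coeff_exists[of L, OF L_1] by blast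
  define g where "g = Abs_fps (\<lambda>r. L (resolvent_poly c r))"
  define h where "h = Abs_fps (\<lambda>r. L (pCons 0 (resolvent_poly c r)))"
  have cg: "(\<Sum>a\<le>r. c $ (r - a) * g $ a) = (of_nat n - 1) * h $ r" for r
    using c by (simp add: g_def h_def)
  have scalar: "((of_nat n - 1) * h) $ r = (of_nat n - 1) * h $ r"
    "(of_nat n * h) $ r = of_nat n * h $ r" for r
    by (simp_all add: left_diff_distrib flip: fps_of_nat)
  have "subordination \<tau> x n c g h"
  proof
    show "\<tau> (poly_eval (resolvent_poly c r) (x i)) = g $ r" for i r
      by (simp add: law g_def)
    show "c * g = (of_nat n - 1) * h"
    proof (rule fps_ext)
      fix r
      have "(c * g) $ r = (g * c) $ r" by (simp only: mult.commute)
      also have "\<dots> = (\<Sum>a\<le>r. c $ (r - a) * g $ a)"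
        unfolding fps_mult_nth atLeast0AtMost by (intro sum.cong refl mult.commute)
      finally show "(c * g) $ r = ((of_nat n - 1) * h) $ r"
        by (simp only: cg scalar)
    qed
    show "g = 1 + fps_X * (of_nat n * h)"
    proof (rule fps_ext)
      fix r
      show "g $ r = (1 + fps_X * (of_nat n * h)) $ r"
      proof (cases r)
        case 0
        then show ?thesis by (simp add: g_def L_1)
      next
        case (Suc q)
        \<comment> \<open>The convolution is \<open>(n - 1) h\<close> by the choice of
          \<open>c\<close>; the extra \<open>h\<close> completes the factor
          \<open>n\<close>.\<close>
        have "g $ Suc q = h $ q + (\<Sum>a\<le>q. c $ (q - a) * g $ a)"
          by (simp add: g_def h_def L_def poly_eval.add poly_eval.sum poly_eval.scale \<tau>.add \<tau>.sum \<tau>.scale)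
        then show ?thesis unfolding cg by (simp add: Suc scalar algebra_simps)
      qed
    qed
  qed
  then show thesis by (rule that)
qed

section \<open>Monotonicity of the free Stein discrepancy\<close>

text \<open>Both moments are the same coefficient of one series \<open>g\<close>, constructed for
  the common number of summands.\<close>

lemma trace_power_sum_card_eq:
  assumes "free_family \<tau> x" "identically_distributed \<tau> x"
    and "finite S" "finite S'" "card S = card S'"
  shows "\<tau> ((\<Sum>i\<in>S. x i) ^ r) = \<tau> ((\<Sum>i\<in>S'. x i) ^ r)"
proof -
  obtain c g h where "subordination \<tau> x (card S') c g h"
    using subordination_exists[OF assms(1,2)] .
  then interpret subordination \<tau> x "card S'" c g h .
  show ?thesis using assms by (simp add: trace_power_sum)
qed

lemma card_subsets_containing:
  assumes "finite A" "i \<in> A" "1 \<le> m"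
  shows "card {S. S \<subseteq> A \<and> card S = m \<and> i \<in> S} = (card A - 1) choose (m - 1)"
proof -
  have "{S. S \<subseteq> A \<and> card S = m \<and> i \<in> S} = insert i ` {T. T \<subseteq> A - {i} \<and> card T = m - 1}"
  proof (intro equalityI subsetI)
    fix S assume S: "S \<in> {S. S \<subseteq> A \<and> card S = m \<and> i \<in> S}"
    then have "S = insert i (S - {i})" "S - {i} \<subseteq> A - {i}" "card (S - {i}) = m - 1"
      by auto
    then show "S \<in> insert i ` {T. T \<subseteq> A - {i} \<and> card T = m - 1}" by blast
  next
    fix S assume "S \<in> insert i ` {T. T \<subseteq> A - {i} \<and> card T = m - 1}"
    then obtain T where T: "S = insert i T" "T \<subseteq> A - {i}" "card T = m - 1" by auto
    then have "finite T" using assms(1) by (meson finite_Diff finite_subset)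
    moreover have "i \<notin> T" using T(2) by auto
    ultimately show "S \<in> {S. S \<subseteq> A \<and> card S = m \<and> i \<in> S}"
      using T assms by auto
  qed
  moreover have "inj_on (insert i) {T. T \<subseteq> A - {i} \<and> card T = m - 1}"
    by (rule inj_onI) (metis (no_types, lifting) Diff_insert_absorb Diff_iff mem_Collect_eq singletonI subsetD)
  ultimately show ?thesis
    using assms n_subsets[of "A - {i}" "m - 1"] by (simp add: card_image)
qed

section \<open>Compression to subsets of the variables\<close>

locale L2_subordination = L2_tensor \<tau> \<iota> tens + subordination \<tau> x n c g h
  for \<tau> :: "'a::star_algebra_1 \<Rightarrow> complex"
    and \<iota> :: "'a \<Rightarrow> 'h::complex_hilbert_space"
    and tens :: "'h \<Rightarrow> 'h \<Rightarrow> 't::complex_hilbert_space"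
    and x :: "'i \<Rightarrow> 'a" and n c g h +
  assumes selfadjoint: "\<And>i. star (x i) = x i"
    and mean_zero: "\<And>i. \<tau> (x i) = 0"
    and variance_one: "\<And>i. \<tau> (x i * x i) = 1"
    and iid: "identically_distributed \<tau> x"
begin

abbreviation sum_over :: "'i set \<Rightarrow> 'a" where
  "sum_over S \<equiv> \<Sum>i\<in>S. x i"

text \<open>The polynomial \<open>Q\<close> with
  \<open>E\<^sub>S P(s\<^sub>n) = Q(s\<^sub>S)\<close> for every \<open>S\<close> of
  \<open>m\<close> elements.\<close>

definition compress :: "nat \<Rightarrow> complex poly \<Rightarrow> complex poly" where
  "compress m P = (\<Sum>r\<le>degree P. smult (coeff P r) (resolvent_poly (coeff_sub m) r))"

text \<open>The part of \<open>\<partial>P(s\<^sub>n)\<close> in the tensor product of the two word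
  spaces; \<open>deriv_mean P\<close> is its coefficient at \<open>1 \<otimes> 1\<close>.\<close>

definition deriv_component :: "complex poly \<Rightarrow> 'i list \<times> 'i list \<Rightarrow> 't" where
  "deriv_component P = (\<lambda>(w, w'). \<Sum>r\<le>degree P. coeff P r *\<^sub>C
     (\<Sum>k<r. elem (component w $ k) (component w' $ (r - 1 - k))))"

definition deriv_mean :: "complex poly \<Rightarrow> complex" where
  "deriv_mean P = (\<Sum>r\<le>degree P. coeff P r * (\<Sum>k<r. g $ k * g $ (r - 1 - k)))"

lemma compress_self: "compress n P = P"
  by (simp add: compress_def resolvent_poly_0 smult_monom poly_as_sum_of_monoms)

lemma star_sum_over: "star (sum_over S) = sum_over S"
  by (induction S rule: infinite_finite_induct) (simp_all add: star_add selfadjoint)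

lemma x_centered: "x i \<in> centered i"
  using generated_star_subalgebra_superset[of "{x i}"] by (auto simp: centered_def mean_zero)

lemma x_in_word_space: "x i \<in> word_space [i]"
  using word_space_Cons[OF x_centered, of 1 "[]" i] word_products_subset[of "[]"] by auto

text \<open>The derivative of a resolvent is a sum of tensor products of resolvents, and each factor
  expands into words over \<open>S\<close>. Both indices stay below \<open>degree P\<close>, so
  words up to that length suffice.\<close>

lemma deriv_eval_compress:
  assumes "finite S"
  shows "deriv_eval (sum_over S) (compress (card S) P)
    = sum (deriv_component P) (words S (degree P) \<times> words S (degree P))"
proof -
  let ?W = "words S (degree P)"
  have "deriv_eval (sum_over S) (compress (card S) P)
      = (\<Sum>r\<le>degree P. coeff P r *\<^sub>C (\<Sum>k<r. elem (\<Sum>w\<in>?W. component w $ k) (\<Sum>w\<in>?W. component w $ (r - 1 - k))))"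
    unfolding compress_def deriv_eval.sum deriv_eval.scale deriv_eval_resolvent_poly
    by (intro sum.cong refl arg_cong[where f = "scaleC _"])
      (simp add: sum_components[OF assms])
  also have "\<dots> = (\<Sum>r\<le>degree P. \<Sum>p\<in>?W \<times> ?W. coeff P r *\<^sub>C (\<Sum>k<r. elem (component (fst p) $ k) (component (snd p) $ (r - 1 - k))))"
  proof (rule sum.cong[OF refl])
    fix r
    have "elem (sum f ?W) (sum f' ?W) = (\<Sum>p\<in>?W \<times> ?W. elem (f (fst p)) (f' (snd p)))" for f f'
      by (simp only: elem_sum_left) (simp add: elem_sum_right sum.cartesian_product case_prod_unfold)
    then show "coeff P r *\<^sub>C (\<Sum>k<r. elem (\<Sum>w\<in>?W. component w $ k) (\<Sum>w\<in>?W. component w $ (r - 1 - k)))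
        = (\<Sum>p\<in>?W \<times> ?W. coeff P r *\<^sub>C (\<Sum>k<r. elem (component (fst p) $ k) (component (snd p) $ (r - 1 - k))))"
      unfolding complex_vector.scale_sum_right[symmetric] by (subst sum.swap) simp
  qed
  also have "\<dots> = sum (deriv_component P) (?W \<times> ?W)"
    by (subst sum.swap) (simp add: deriv_component_def case_prod_unfold)
  finally show ?thesis .
qed

lemma deriv_component_orthogonal:
  assumes "distinct_adj (fst p)" "distinct_adj (snd p)" "distinct_adj (fst q)" "distinct_adj (snd q)"
    and "p \<noteq> q"
  shows "cinner (deriv_component P p) (deriv_component Q q) = 0"
proof -
  have *: "\<tau> (star (component (fst p) $ k) * component (fst q) $ l)
      * \<tau> (star (component (snd p) $ k') * component (snd q) $ l') = 0" for k k' l l'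
    using assms word_space_orthogonal component_in_word_space by (metis prod_eqI mult_eq_0_iff)
  show ?thesis
    by (simp only: deriv_component_def case_prod_unfold cinner_sum_left cinner_sum_right
        cinner_scaleC_left cinner_scaleC_right cinner_elem *) simp
qed

lemma deriv_component_Nil: "deriv_component P ([], []) = deriv_mean P *\<^sub>C elem 1 1"
  by (simp add: deriv_component_def deriv_mean_def component_Nil_nth elem_scaleC_left elem_scaleC_right
      complex_vector.scale_sum_left[symmetric] scaleC_scaleC)

lemma cinner_elem_1_1: "cinner (elem 1 1) (elem 1 1) = 1"
  by (simp add: cinner_elem trace_one)

lemma deriv_eval_X: "deriv_eval y (monom 1 1) = elem 1 1"
  by (simp only: deriv_eval_monom) simp

lemma cinner_one_deriv_component:
  assumes "distinct_adj (fst p)" "distinct_adj (snd p)" "p \<noteq> ([], [])"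
  shows "cinner (elem 1 1) (deriv_component P p) = 0"
proof -
  have *: "\<tau> (component (fst p) $ k) * \<tau> (component (snd p) $ l) = 0" for k l
    using assms trace_component by (metis prod_eqI fst_conv snd_conv mult_eq_0_iff)
  show ?thesis
    by (simp only: deriv_component_def case_prod_unfold cinner_sum_right cinner_scaleC_right
        cinner_elem star_one mult_1_left *) simp
qed

text \<open>Only the pair of two empty words is left out; one of the two words may be empty.\<close>

definition nonempty_pairs :: "'i set \<Rightarrow> nat \<Rightarrow> ('i list \<times> 'i list) set" where
  "nonempty_pairs S N = words S N \<times> words S N - {([], [])}"

lemma finite_nonempty_pairs: "finite S \<Longrightarrow> finite (nonempty_pairs S N)"
  by (simp add: nonempty_pairs_def finite_words)

lemma nonempty_pairsD:
  assumes "p \<in> nonempty_pairs S N"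
  shows "distinct_adj (fst p)" "distinct_adj (snd p)" "p \<noteq> ([], [])"
    "set (fst p) \<union> set (snd p) \<subseteq> S" "set (fst p) \<union> set (snd p) \<noteq> {}"
  using assms by (auto simp: nonempty_pairs_def words_def)

lemma deriv_eval_compress_split:
  assumes "finite S"
  shows "deriv_eval (sum_over S) (compress (card S) P)
    = deriv_mean P *\<^sub>C elem 1 1 + sum (deriv_component P) (nonempty_pairs S (degree P))"
proof -
  have "([], []) \<in> words S (degree P) \<times> words S (degree P)" by (simp add: words_def)
  then show ?thesis
    using finite_words[OF assms]
    by (simp add: deriv_eval_compress[OF assms] nonempty_pairs_def sum.remove
        deriv_component_Nil[symmetric])
qed

lemma cinner_one_deriv_eval_compress:
  assumes "finite S"
  shows "cinner (elem 1 1) (deriv_eval (sum_over S) (compress (card S) P)) = deriv_mean P"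
  by (simp add: deriv_eval_compress_split[OF assms] cinner_add_right cinner_scaleC_right
      cinner_elem_1_1 cinner_sum_right cinner_one_deriv_component nonempty_pairsD)

lemma norm_sum_deriv_component:
  assumes "finite S"
  shows "(norm (sum (deriv_component P) (nonempty_pairs S N)))\<^sup>2
    = (\<Sum>p\<in>nonempty_pairs S N. (norm (deriv_component P p))\<^sup>2)"
proof (rule norm_sum_Pythagorean)
  show "pairwise (\<lambda>p q. orthogonal (deriv_component P p) (deriv_component P q)) (nonempty_pairs S N)"
    unfolding pairwise_def orthogonal_def Re_cinner[symmetric]
    by (auto simp: deriv_component_orthogonal nonempty_pairsD)
qed (rule finite_nonempty_pairs[OF assms])

lemma norm_sum_deriv_component_le:
  assumes "finite S"
  shows "(norm (sum (deriv_component P) (nonempty_pairs S (degree P))))\<^sup>2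
    \<le> (norm (deriv_eval (sum_over S) (compress (card S) P)))\<^sup>2"
proof -
  let ?e = "deriv_mean P *\<^sub>C elem 1 1" and ?v = "sum (deriv_component P) (nonempty_pairs S (degree P))"
  have "cinner (elem 1 1) ?v = 0"
    by (simp add: cinner_sum_right cinner_one_deriv_component nonempty_pairsD)
  then have "cinner ?e ?v = 0" by (simp add: cinner_scaleC_left)
  then have "inner ?e ?v = 0" by (simp flip: Re_cinner)
  then have "(norm (?e + ?v))\<^sup>2 = (norm ?e)\<^sup>2 + (norm ?v)\<^sup>2"
    by (simp add: power2_norm_eq_inner inner_add_left inner_add_right inner_commute)
  then show ?thesis by (simp add: deriv_eval_compress_split[OF assms])
qed

text \<open>Since \<open>\<partial>X = 1 \<otimes> 1\<close>, removing the constant component leaves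
  the derivative of a polynomial. Its norm depends only on the moments of the sum, hence on the
  number of summands.\<close>

lemma norm_sum_deriv_component_exchangeable:
  assumes "finite S" "finite S'" "card S = card S'"
  shows "norm (sum (deriv_component P) (nonempty_pairs S (degree P)))
    = norm (sum (deriv_component P) (nonempty_pairs S' (degree P)))"
proof -
  let ?P = "compress (card S) P + smult (- deriv_mean P) (monom 1 1)"
  have *: "sum (deriv_component P) (nonempty_pairs T (degree P)) = deriv_eval (sum_over T) ?P"
    if "finite T" "card T = card S" for T
    using deriv_eval_compress_split[OF that(1), of P] that(2)
    by (simp only: deriv_eval.add deriv_eval.scale deriv_eval_X complex_vector.scale_minus_left) simp
  have "cinner (deriv_eval (sum_over S) ?P) (deriv_eval (sum_over S) ?P)
      = cinner (deriv_eval (sum_over S') ?P) (deriv_eval (sum_over S') ?P)"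
    by (intro cinner_deriv_eval_eq star_sum_over
        trace_power_sum_card_eq[OF free_family_axioms iid assms])
  then have "(norm (deriv_eval (sum_over S) ?P))\<^sup>2 = (norm (deriv_eval (sum_over S') ?P))\<^sup>2"
    by (simp only: cinner_self of_real_eq_iff)
  then show ?thesis using assms by (simp add: *)
qed

text \<open>Each nonempty pair of words survives the projection onto at most a fraction \<open>m / n\<close> of the
  \<open>m\<close>-element subsets, whereas the constant component survives all of them.\<close>

lemma variance_drop:
  assumes "finite A" "card A = n" "S \<subseteq> A" "card S = m" "1 \<le> m"
  shows "real n * (norm (sum (deriv_component P) (nonempty_pairs S (degree P))))\<^sup>2
    \<le> real m * (norm (deriv_eval (sum_over A) P))\<^sup>2"
proof -
  let ?N = "degree P" and ?F = "{S. S \<subseteq> A \<and> card S = m}"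
  let ?b = "\<lambda>p. (norm (deriv_component P p))\<^sup>2"
  let ?V = "(norm (sum (deriv_component P) (nonempty_pairs S ?N)))\<^sup>2"
  let ?q = "(n - 1) choose (m - 1)"
  have fin: "finite T" if "T \<subseteq> A" for T using that assms(1) finite_subset by blast
  \<comment> \<open>By exchangeability the norm for \<open>S\<close> equals its average over all
    \<open>m\<close>-element subsets of \<open>A\<close>.\<close>
  have "real (n choose m) * ?V = (\<Sum>T\<in>?F. ?V)"
    using n_subsets[OF assms(1), of m] assms(2) by simp
  also have "\<dots> = (\<Sum>T\<in>?F. (norm (sum (deriv_component P) (nonempty_pairs T ?N)))\<^sup>2)"
    using assms fin by (intro sum.cong refl arg_cong[where f = "\<lambda>z. z\<^sup>2"]
        norm_sum_deriv_component_exchangeable) auto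
  also have "\<dots> = (\<Sum>T\<in>?F. \<Sum>p\<in>nonempty_pairs T ?N. ?b p)"
    using fin by (intro sum.cong refl norm_sum_deriv_component) auto
  also have "\<dots> = (\<Sum>T\<in>?F. \<Sum>p | p \<in> nonempty_pairs A ?N \<and> set (fst p) \<union> set (snd p) \<subseteq> T. ?b p)"
    by (intro sum.cong refl) (auto simp: nonempty_pairs_def words_def)
  also have "\<dots> = (\<Sum>p\<in>nonempty_pairs A ?N. \<Sum>T | T \<in> ?F \<and> set (fst p) \<union> set (snd p) \<subseteq> T. ?b p)"
    using assms(1) finite_nonempty_pairs[OF assms(1)] by (intro sum.swap_restrict) auto
  also have "\<dots> \<le> (\<Sum>p\<in>nonempty_pairs A ?N. real ?q * ?b p)"
  proof (rule sum_mono)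
    fix p assume p: "p \<in> nonempty_pairs A ?N"
    then obtain i where i: "i \<in> set (fst p) \<union> set (snd p)" "i \<in> A"
      using nonempty_pairsD(4,5)[OF p] by (metis ex_in_conv subsetD)
    \<comment> \<open>A subset containing all letters of \<open>p\<close> contains the letter
      \<open>i\<close>; only \<open>(n - 1) choose (m - 1)\<close> subsets do.\<close>
    have "card {T \<in> ?F. set (fst p) \<union> set (snd p) \<subseteq> T} \<le> card {T. T \<subseteq> A \<and> card T = m \<and> i \<in> T}"
      using i assms(1) by (intro card_mono) auto
    then have "real (card {T \<in> ?F. set (fst p) \<union> set (snd p) \<subseteq> T}) \<le> real ?q"
      using card_subsets_containing[OF assms(1) i(2) assms(5)] assms(2) by simp
    then show "(\<Sum>T | T \<in> ?F \<and> set (fst p) \<union> set (snd p) \<subseteq> T. ?b p) \<le> real ?q * ?b p"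
      by (simp add: mult_right_mono)
  qed
  also have "\<dots> = real ?q * (norm (sum (deriv_component P) (nonempty_pairs A ?N)))\<^sup>2"
    by (simp add: norm_sum_deriv_component[OF assms(1)] sum_distrib_left)
  also have "\<dots> \<le> real ?q * (norm (deriv_eval (sum_over A) P))\<^sup>2"
    using norm_sum_deriv_component_le[OF assms(1), of P]
    by (intro mult_left_mono) (simp_all add: assms(2) compress_self)
  finally have le: "real (n choose m) * ?V \<le> real ?q * (norm (deriv_eval (sum_over A) P))\<^sup>2" .
  have "m \<le> n" using assms card_mono by blast
  then have "0 < n choose m" by simp
  \<comment> \<open>The absorption identity turns the ratio of the two binomial coefficients into
    \<open>m / n\<close>.\<close>
  have binom: "real m * real (n choose m) = real n * real ?q"
    using assms(5) times_binomial_minus1_eq[of m n] by (simp flip: of_nat_mult)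
  have "real (n choose m) * (real n * ?V) = real n * (real (n choose m) * ?V)"
    by (simp only: mult.left_commute)
  also have "\<dots> \<le> real n * (real ?q * (norm (deriv_eval (sum_over A) P))\<^sup>2)"
    using le by (rule mult_left_mono) simp
  also have "\<dots> = real (n choose m) * (real m * (norm (deriv_eval (sum_over A) P))\<^sup>2)"
    by (simp only: mult.assoc[symmetric] binom[symmetric] mult.commute[of "real m" "real (n choose m)"])
  finally show ?thesis using \<open>0 < n choose m\<close> by simp
qed

section \<open>Pairings of sums with compressed polynomials\<close>

lemma trace_x_compress:
  assumes "finite S" "i \<in> S"
  shows "\<tau> (x i * poly_eval (compress (card S) P) (sum_over S))
    = (\<Sum>r\<le>degree P. coeff P r * \<tau> (x i * component [i] $ r))"
proof -
  have "\<tau> (x i * poly_eval (resolvent_poly (coeff_sub (card S)) r) (sum_over S))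
      = \<tau> (x i * component [i] $ r)" for r
  proof -
    have "\<tau> (x i * poly_eval (resolvent_poly (coeff_sub (card S)) r) (sum_over S))
        = (\<Sum>w\<in>words S (Suc r). \<tau> (x i * component w $ r))"
      by (simp only: sum_components[OF assms(1) le_SucI[OF order_refl], symmetric] sum_distrib_left \<tau>.sum)
    also have "\<dots> = (\<Sum>w\<in>{[i]}. \<tau> (x i * component w $ r))"
    proof (rule sum.mono_neutral_right[OF finite_words[OF assms(1)]])
      \<comment> \<open>As \<open>x i\<close> lies in \<open>word_space [i]\<close>, only the word
        \<open>[i]\<close> survives; the bound \<open>Suc r\<close> admits it even for
        \<open>r = 0\<close>.\<close>
      show "{[i]} \<subseteq> words S (Suc r)" using assms by (simp add: words_def)
      have "\<tau> (x i * component w $ r) = 0" if "distinct_adj w" "w \<noteq> [i]" for w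
        using word_space_orthogonal[of "[i]" w "x i"] that x_in_word_space component_in_word_space
        by (simp add: selfadjoint)
      then show "\<forall>w\<in>words S (Suc r) - {[i]}. \<tau> (x i * component w $ r) = 0"
        by (auto simp: words_def)
    qed
    finally show ?thesis by simp
  qed
  then show ?thesis
    by (simp add: compress_def poly_eval.sum poly_eval.scale sum_distrib_left scaleC_mult_right
        \<tau>.sum \<tau>.scale)
qed

text \<open>For the one-element set \<open>{k}\<close>, the trace becomes a pairing of
  \<open>x k\<close> with a polynomial in \<open>x k\<close>, which depends only on the common
  law.\<close>

lemma trace_x_component_eq: "\<tau> (x i * component [i] $ r) = \<tau> (x j * component [j] $ r)"
proof -
  have law: "\<tau> (x i * poly_eval P (x i)) = \<tau> (x j * poly_eval P (x j))" for P
  proof -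
    have "\<tau> (x i ^ Suc r) = \<tau> (x j ^ Suc r)" for r
      using iid[unfolded identically_distributed_def, rule_format, of "Suc r" i j] by simp
    then show ?thesis
      by (simp add: poly_eval_def sum_distrib_left scaleC_mult_right \<tau>.sum \<tau>.scale)
  qed
  have *: "\<tau> (x k * poly_eval (compress 1 (monom 1 r)) (x k)) = \<tau> (x k * component [k] $ r)" for k
  proof -
    have "(\<Sum>q\<le>r. coeff (monom 1 r) q * \<tau> (x k * component [k] $ q))
        = (\<Sum>q\<le>r. if q = r then \<tau> (x k * component [k] $ q) else 0)"
      by (intro sum.cong refl) simp
    then show ?thesis
      using trace_x_compress[of "{k}" k "monom 1 r"] by (simp add: degree_monom_eq)
  qed
  show ?thesis using law *[of i] *[of j] by metis
qed

text \<open>Every summand contributes the same number \<open>b\<close>, independent of the set, so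
  the trace is proportional to the number of summands.\<close>

lemma trace_sum_compress:
  assumes "finite S" "finite S'"
  shows "of_nat (card S') * \<tau> (sum_over S * poly_eval (compress (card S) P) (sum_over S))
    = of_nat (card S) * \<tau> (sum_over S' * poly_eval (compress (card S') P) (sum_over S'))"
proof -
  define b where "b = (\<Sum>r\<le>degree P. coeff P r * \<tau> (x undefined * component [undefined] $ r))"
  have "\<tau> (sum_over T * poly_eval (compress (card T) P) (sum_over T)) = of_nat (card T) * b"
    if "finite T" for T
  proof -
    have "\<tau> (sum_over T * poly_eval (compress (card T) P) (sum_over T))
        = (\<Sum>i\<in>T. \<tau> (x i * poly_eval (compress (card T) P) (sum_over T)))"
      by (simp add: sum_distrib_right \<tau>.sum)
    also have "\<dots> = (\<Sum>i\<in>T. b)"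
    proof (rule sum.cong[OF refl])
      fix i assume "i \<in> T"
      show "\<tau> (x i * poly_eval (compress (card T) P) (sum_over T)) = b"
        unfolding b_def trace_x_compress[OF that \<open>i \<in> T\<close>]
        by (intro sum.cong refl arg_cong2[where f = "(*)"] trace_x_component_eq)
    qed
    finally show ?thesis by simp
  qed
  from this[OF assms(1)] this[OF assms(2)] show ?thesis
    by (simp only: mult.left_commute)
qed

lemma trace_sum_squared: "finite S \<Longrightarrow> \<tau> (sum_over S * sum_over S) = of_nat (card S)"
proof -
  assume "finite S"
  have "\<tau> (x i * x j) = (if i = j then 1 else 0)" for i j
    using word_space_orthogonal[of "[i]" "[j]" "x i" "x j"]
    by (simp add: variance_one selfadjoint x_in_word_space)
  then show ?thesis
    using \<open>finite S\<close> by (simp add: sum_distrib_left sum_distrib_right \<tau>.sum sum.delta)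
qed

text \<open>After compression to \<open>S\<close> the functional is the pairing of
  \<open>K - 1 \<otimes> 1\<close> with the part \<open>?v\<close> orthogonal to
  \<open>1 \<otimes> 1\<close>. Cauchy-Schwarz and \<open>variance_drop\<close> finish.\<close>

lemma discrepancy_functional_bound:
  assumes "finite A" "card A = n" "S \<subseteq> A" "card S = m" "1 \<le> m"
    and K: "\<And>P. complex_of_real (1 / m) * \<tau> (sum_over S * poly_eval P (sum_over S))
      = cinner K (deriv_eval (sum_over S) P)"
  shows "cmod (complex_of_real (1 / n) * \<tau> (sum_over A * poly_eval P (sum_over A))
      - cinner (elem 1 1) (deriv_eval (sum_over A) P))
    \<le> sqrt (m / n) * norm (K - elem 1 1) * norm (deriv_eval (sum_over A) P)"
proof -
  let ?v = "sum (deriv_component P) (nonempty_pairs S (degree P))"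
  let ?a = "deriv_mean P" and ?e = "elem 1 1" and ?Q = "compress m P"
  have "finite S" using assms finite_subset by blast
  have "m \<le> n" using assms card_mono by blast
  have "n > 0" "m > 0" using \<open>m \<le> n\<close> assms by auto
  have "of_nat m * \<tau> (sum_over A * poly_eval P (sum_over A))
      = of_nat n * \<tau> (sum_over S * poly_eval ?Q (sum_over S))"
    using trace_sum_compress[OF \<open>finite A\<close> \<open>finite S\<close>, of P] assms(2,4) by (simp add: compress_self)
  then have "complex_of_real (1 / n) * \<tau> (sum_over A * poly_eval P (sum_over A))
      = complex_of_real (1 / m) * \<tau> (sum_over S * poly_eval ?Q (sum_over S))"
    using \<open>n > 0\<close> \<open>m > 0\<close> by (simp add: field_simps)
  also have "\<dots> = cinner K (?a *\<^sub>C ?e + ?v)"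
    using K[of ?Q] deriv_eval_compress_split[OF \<open>finite S\<close>, of P] assms(4) by simp
  also have "\<dots> = ?a + cinner K ?v"
  proof -
    \<comment> \<open>The kernel identity is tested with \<open>P = X\<close>; the sum over
      \<open>S\<close> has variance \<open>m\<close>.\<close>
    have "cinner K ?e = 1"
      using K[of "monom 1 1"] trace_sum_squared[OF \<open>finite S\<close>] assms(4) \<open>m > 0\<close>
      by (simp add: deriv_eval_X[simplified] scaleC_one)
    then show ?thesis by (simp add: cinner_add_right cinner_scaleC_right)
  qed
  finally have 1: "complex_of_real (1 / n) * \<tau> (sum_over A * poly_eval P (sum_over A)) = ?a + cinner K ?v" .
  have 2: "cinner ?e (deriv_eval (sum_over A) P) = ?a"
    using cinner_one_deriv_eval_compress[OF \<open>finite A\<close>, of P] assms(2) by (simp add: compress_self)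
  have 3: "cinner ?e ?v = 0"
    by (simp add: cinner_sum_right cinner_one_deriv_component nonempty_pairsD)
  have "norm ?v \<le> sqrt (m / n) * norm (deriv_eval (sum_over A) P)"
  proof (rule power2_le_imp_le)
    show "(norm ?v)\<^sup>2 \<le> (sqrt (m / n) * norm (deriv_eval (sum_over A) P))\<^sup>2"
      using variance_drop[OF assms(1-5), of P] \<open>n > 0\<close>
      by (simp add: power_mult_distrib field_simps)
  qed simp
  then have "norm (K - ?e) * norm ?v \<le> norm (K - ?e) * (sqrt (m / n) * norm (deriv_eval (sum_over A) P))"
    by (intro mult_left_mono) auto
  moreover have "cmod (cinner (K - ?e) ?v) \<le> norm (K - ?e) * norm ?v"
    by (rule cinner_Cauchy_Schwarz)
  ultimately show ?thesis
    unfolding 1 2 by (simp add: cinner_diff_left 3 mult_ac)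
qed

text \<open>The vector \<open>D\<close> representing the bounded functional \<open>\<phi>\<close> is
  the difference between the new kernel and \<open>1 \<otimes> 1\<close>.\<close>

lemma exists_free_stein_kernel:
  assumes "finite A" "card A = n" "S \<subseteq> A" "card S = m" "1 \<le> m"
    and K: "free_stein_kernel \<iota> tens (complex_of_real (1 / sqrt m) *\<^sub>C sum_over S) K"
  shows "\<exists>K'. free_stein_kernel \<iota> tens (complex_of_real (1 / sqrt n) *\<^sub>C sum_over A) K'
    \<and> norm (K' - tens (\<iota> 1) (\<iota> 1)) \<le> sqrt (m / n) * norm (K - tens (\<iota> 1) (\<iota> 1))"
proof -
  let ?y = "sum_over A"
  have "m \<le> n" using assms card_mono by blast
  have "n > 0" "m > 0" using \<open>m \<le> n\<close> assms by auto
  have mean: "\<tau> (sum_over T) = 0" for T by (simp add: \<tau>.sum mean_zero)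
  have K': "complex_of_real (1 / m) * \<tau> (sum_over S * poly_eval P (sum_over S))
      = cinner K (deriv_eval (sum_over S) P)" for P
  proof -
    have "\<forall>P. complex_of_real ((1 / sqrt m)\<^sup>2) * \<tau> (sum_over S * poly_eval P (sum_over S))
        = cinner K (deriv_eval (sum_over S) P)"
      using K \<open>m > 0\<close> by (subst (asm) free_stein_kernel_scaled_iff) (simp_all add: star_sum_over mean)
    then show ?thesis by (simp add: power_divide)
  qed
  define \<phi> where "\<phi> P = complex_of_real (1 / n) * \<tau> (?y * poly_eval P ?y) - cinner (elem 1 1) (deriv_eval ?y P)" for P
  have "Vector_Spaces.linear smult (*) \<phi>"
    using vector_space_poly linear
    by (simp add: Vector_Spaces.linear_iff \<phi>_def poly_eval.add poly_eval.scale deriv_eval.add deriv_eval.scale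
        distrib_left scaleC_mult_right \<tau>.add \<tau>.scale cinner_add_right cinner_scaleC_right
        algebra_simps)
  then obtain D where D: "\<And>P. cinner D (deriv_eval ?y P) = \<phi> P"
    and norm_D: "norm D \<le> sqrt (m / n) * norm (K - elem 1 1)"
    using bounded_linear_functional_representation[OF linear_deriv_eval, of \<phi> "sqrt (m / n) * norm (K - elem 1 1)" ?y]
      discrepancy_functional_bound[OF assms(1-5) K'] by (auto simp: \<phi>_def)
  have "free_stein_kernel \<iota> tens (complex_of_real (1 / sqrt n) *\<^sub>C ?y) (D + elem 1 1)"
  proof (subst free_stein_kernel_scaled_iff)
    show "\<forall>P. complex_of_real ((1 / sqrt n)\<^sup>2) * \<tau> (?y * poly_eval P ?y) = cinner (D + elem 1 1) (deriv_eval ?y P)"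
      by (simp add: cinner_add_left D \<phi>_def power_divide)
  qed (use \<open>n > 0\<close> in \<open>simp_all add: star_sum_over mean\<close>)
  with norm_D show ?thesis
    by (intro exI[of _ "D + elem 1 1"]) (simp add: elem_def)
qed

end

theorem corollary1p3:
  fixes \<tau> :: "'a::star_algebra_1 \<Rightarrow> complex"
    and \<iota> :: "'a \<Rightarrow> 'h::complex_hilbert_space"
    and tens :: "'h \<Rightarrow> 'h \<Rightarrow> 't::complex_hilbert_space"
    and x :: "nat \<Rightarrow> 'a"
    and s :: "nat \<Rightarrow> 'a"
    and m n :: nat
  assumes "nc_prob_space \<tau>"
    and "L2_completion \<tau> \<iota>"
    and "hilbert_tensor_product tens"
    and "\<And>i. star (x i) = x i"
    and "free_variables \<tau> x"
    and "identically_distributed \<tau> x"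
    and "\<And>i. \<tau> (x i) = 0"
    and "\<And>i. norm (\<iota> (x i)) = 1"
    and "\<And>k. s k = (\<Sum>i<k. x i)"
    and "1 \<le> m" and "m \<le> n"
  shows "free_stein_discrepancy \<iota> tens (complex_of_real (1 / sqrt (real n)) *\<^sub>C s n)
    \<le> ereal (sqrt (real m / real n))
       * free_stein_discrepancy \<iota> tens (complex_of_real (1 / sqrt (real m)) *\<^sub>C s m)"
proof -
  interpret L2_tensor \<tau> \<iota> tens
    using assms(2,3) by (rule L2_tensor.intro)
  have free: "free_family \<tau> x"
    using assms(1,5) by (simp add: free_family_def free_family_axioms_def)
  obtain c g h where "subordination \<tau> x n c g h"
    using subordination_exists[OF free assms(6)] .
  then interpret subordination \<tau> x n c g h .
  have "\<tau> (x i * x i) = 1" for i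
    using cinner_embedding[of "x i" "x i"] by (simp add: assms(4,8) cinner_self)
  then interpret L2_subordination \<tau> \<iota> tens x n c g h
    by unfold_locales (use assms in simp_all)
  let ?c = "sqrt (real m / real n)"
  let ?K = "\<lambda>k. {K. free_stein_kernel \<iota> tens (complex_of_real (1 / sqrt (real k)) *\<^sub>C s k) K}"
  let ?d = "\<lambda>K. ereal (norm (K - tens (\<iota> 1) (\<iota> 1)))"
  \<comment> \<open>Positivity lets the factor pass through the infimum, including the empty infimum
    \<open>\<infinity>\<close>.\<close>
  have "?c > 0" using assms(10,11) by simp
  have "(INF K\<in>?K n. ?d K) \<le> Inf {ereal ?c * z |z. z \<in> ?d ` ?K m}"
  proof (rule Inf_greatest, clarify)
    fix K assume "free_stein_kernel \<iota> tens (complex_of_real (1 / sqrt (real m)) *\<^sub>C s m) K"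
    then obtain K' where "K' \<in> ?K n" "norm (K' - tens (\<iota> 1) (\<iota> 1)) \<le> ?c * norm (K - tens (\<iota> 1) (\<iota> 1))"
      using exists_free_stein_kernel[of "{..<n}" "{..<m}" m K] assms(9-11) by auto
    then show "(INF K\<in>?K n. ?d K) \<le> ereal ?c * ?d K"
      by (intro INF_lower2[of K']) auto
  qed
  also have "\<dots> = ereal ?c * (INF K\<in>?K m. ?d K)"
    using ereal_Inf_cmult[OF \<open>?c > 0\<close>, of "\<lambda>z. z \<in> ?d ` ?K m"] by simp
  finally show ?thesis by (simp add: free_stein_discrepancy_def)
qed

end
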